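(* As functions of $x$ and $q$ (with $|q|<1$), $$2x(q^2;q^2)_\infty^2[C^*(x;q^2)]^3J(-x;q)=(1+x)\delta_qN^*+xN^*+2x\delta_xN^*+(1+x)\delta_x^2N^*,$$ where $N^*=N^*(1,1/q,x;q^2)$, and $$2x(q^2;q^2)_\infty^2[C(x;q^2)]^3J(-x;q)=(1+x)(1-x)^2\delta_qN+2x(1+x)N+4x(1-x)\delta_xN+(1+x)(1-x)^2\delta_x^2N,$$ where $N=N(1,1/q,x;q^2)$.
   Context: $(a_1,\dots,a_j;p)_\infty=\prod_{t\ge0}\prod_i(1-a_ip^t)$, $(a_1,\dots,a_j;p)_n=(a_1,\dots,a_j;p)_\infty/(a_1p^n,\dots,a_jp^n;p)_\infty$. $N(1,1/q,x;q^2):=\sum_{n\ge0}\frac{(-1,-q;q^2)_nq^n}{(xq^2,q^2/x;q^2)_n}$, $N^*(1,1/q,x;q^2):=N(1,1/q,x;q^2)/(1-x)$. $C(x;q^2):=\frac{(q^2;q^2)_\infty}{(xq^2,q^2/x;q^2)_\infty}$, $C^*(x;q^2):=C(x;q^2)/(1-x)$, $J(-x;q):=(-x,-q/x;q)_\infty$. $\delta_q:=q\frac{\partial}{\partial q}$, $\delta_x:=x\frac{\partial}{\partial x}$; a product like $(1+x)\delta_x^2N$ means multiplication after differentiation. *)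

theory Defs
  imports "HOL-Analysis.Analysis"
begin

text \<open>The symbols \<open>(a\<^sub>1,\<dots>,a\<^sub>j; p)\<^sub>\<infinity>\<close> and \<open>(a\<^sub>1,\<dots>,a\<^sub>j; p)\<^sub>n\<close>, with the parameters given as a list.\<close>

definition qpoch_inf :: "complex list \<Rightarrow> complex \<Rightarrow> complex" where
  "qpoch_inf as p = (\<Prod>t. \<Prod>a\<leftarrow>as. (1 - a * p ^ t))"

definition qpoch :: "complex list \<Rightarrow> complex \<Rightarrow> nat \<Rightarrow> complex" where
  "qpoch as p n = qpoch_inf as p / qpoch_inf (map (\<lambda>a. a * p ^ n) as) p"

text \<open>\<open>N_fun x q\<close> is \<open>N(1, 1/q, x; q\<^sup>2)\<close>: the second argument is \<open>q\<close>, not the base \<open>q\<^sup>2\<close>, since the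
  summand depends on \<open>q\<close> itself. In \<open>C_fun x p\<close> and \<open>J_fun z p\<close> the second argument is the base.\<close>

definition N_fun :: "complex \<Rightarrow> complex \<Rightarrow> complex" where
  "N_fun x q = (\<Sum>n. qpoch [-1, -q] (q^2) n * q ^ n / qpoch [x * q^2, q^2 / x] (q^2) n)"

definition N_star :: "complex \<Rightarrow> complex \<Rightarrow> complex" where
  "N_star x q = N_fun x q / (1 - x)"

definition C_fun :: "complex \<Rightarrow> complex \<Rightarrow> complex" where
  "C_fun x p = qpoch_inf [p] p / qpoch_inf [x * p, p / x] p"

definition C_star :: "complex \<Rightarrow> complex \<Rightarrow> complex" where
  "C_star x p = C_fun x p / (1 - x)"

definition J_fun :: "complex \<Rightarrow> complex \<Rightarrow> complex" where
  "J_fun z p = qpoch_inf [z, p / z] p"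

text \<open>The Euler operators \<open>x \<partial>/\<partial>x\<close> and \<open>q \<partial>/\<partial>q\<close>, acting on functions \<open>F x q\<close>.\<close>

definition delta_x :: "(complex \<Rightarrow> complex \<Rightarrow> complex) \<Rightarrow> complex \<Rightarrow> complex \<Rightarrow> complex" where
  "delta_x F x q = x * deriv (\<lambda>y. F y q) x"

definition delta_q :: "(complex \<Rightarrow> complex \<Rightarrow> complex) \<Rightarrow> complex \<Rightarrow> complex \<Rightarrow> complex" where
  "delta_q F x q = q * deriv (\<lambda>r. F x r) q"

end

theory Submission
  imports Defs "HOL-Complex_Analysis.Complex_Analysis"
begin

text \<open>
  Write \<open>\<theta>(x) = J(x; q\<^sup>2)\<close> and \<open>G = (1 + x) N\<^sup>*\<close>. The right-hand side of the first equation is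
  \<open>(\<delta>\<^sub>q + \<delta>\<^sub>x\<^sup>2) G\<close>. Telescoping the defining series gives \<open>G(q\<^sup>2 x) = - q x G(x) + 1 - q x\<close>, and the heat
  operator turns this into \<open>V(q\<^sup>2 x) = - q x V(x)\<close> for \<open>V = (\<delta>\<^sub>q + \<delta>\<^sub>x\<^sup>2) G\<close>. As \<open>G \<theta>\<close> is holomorphic for
  \<open>x \<noteq> 0\<close>, so is \<open>F = \<theta>\<^sup>3 V\<close>, with \<open>F(q\<^sup>2 x) = q x\<^bsup>-2\<^esup> F(x)\<close>; moreover \<open>F(1/x) = x\<^bsup>-3\<^esup> F(x)\<close>. These two
  relations force \<open>F\<close> to vanish at all zeros \<open>- q\<^sup>k\<close> of \<open>K(x) = x J(-x; q)\<close>, which has simple zeros and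
  the same multiplier as \<open>F\<close>, so \<open>F / K\<close> is constant by Liouville's theorem. The constant is read off
  at \<open>x = 1\<close>, where the series for \<open>N\<close> is evaluated by the q-Gauss sum.
\<close>

subsection \<open>Holomorphic functions of two variables\<close>

text \<open>Why the heat operator L = delta_q + delta_x^2 works: applied to G(q^2 x), delta_q yields
  an extra 2 delta_x because the dilation involves q, while multiplication by q x conjugates delta_q
  and delta_x to delta_q + 1 and delta_x + 1. The lower order terms cancel, and L - 2 delta_x
  annihilates both 1 and q x, so the inhomogeneity 1 - q x disappears. Two derivatives in x turn
  simple poles of G into triple ones, whence the cube of theta. A function with the multiplier of F
  has two zeros per annulus. The points -1 and -q are fixed by inversion modulo dilation by q^2, and
  there the two relations read F = -F; one further value then determines F. Poles are the main
  obstacle: every functional equation is therefore proved for theta and for the numerator G theta,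
  both holomorphic for x \<noteq> 0, and the quotient reappears only at the end. Since q enters the
  dilation, a chain rule and iterated partial derivatives in two complex variables are
  needed.\<close>

text \<open>Separate holomorphy plus joint continuity: easy to verify for products and series, and
  strong enough for uniform estimates on compact boxes.\<close>

definition hol2 :: "(complex \<Rightarrow> complex \<Rightarrow> complex) \<Rightarrow> (complex \<times> complex) set \<Rightarrow> bool" where
  "hol2 f S \<longleftrightarrow> open S \<and> continuous_on S (\<lambda>(x, y). f x y) \<and>
     (\<forall>y. (\<lambda>x. f x y) holomorphic_on {x. (x, y) \<in> S}) \<and> (\<forall>x. f x holomorphic_on {y. (x, y) \<in> S})"

lemma open_slices:
  assumes "open S"
  shows "open {x. (x, y) \<in> S}" "open {y. (x, y) \<in> S}"
proof -
  have "{x. (x, y) \<in> S} = (\<lambda>x. (x, y)) -` S" "{y. (x, y) \<in> S} = (\<lambda>y. (x, y)) -` S"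
    by auto
  then show "open {x. (x, y) \<in> S}" "open {y. (x, y) \<in> S}"
    by (auto intro!: open_vimage assms continuous_intros)
qed

lemma hol2_swap:
  assumes "hol2 f S"
  shows "hol2 (\<lambda>y x. f x y) {(y, x). (x, y) \<in> S}"
proof -
  have eq: "{(y, x). (x, y) \<in> S} = (\<lambda>z. (snd z, fst z)) -` S" by auto
  have cs: "continuous_on A (\<lambda>z. (snd z, fst z))" for A :: "(complex \<times> complex) set"
    by (intro continuous_intros)
  have "continuous_on ((\<lambda>z. (snd z, fst z)) -` S) (\<lambda>z. (\<lambda>(x, y). f x y) (snd z, fst z))"
    using assms unfolding hol2_def by (intro continuous_on_compose2[OF _ cs]) auto
  moreover have "open ((\<lambda>z. (snd z, fst z)) -` S)"
    using assms cs unfolding hol2_def by (intro open_vimage) auto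
  ultimately show ?thesis
    using assms unfolding eq hol2_def by (simp add: case_prod_unfold)
qed

lemma hol2_box:
  assumes "hol2 f S" "(x0, y0) \<in> S"
  obtains R where "R > 0" "cball x0 R \<times> cball y0 R \<subseteq> S"
proof -
  have "open S" using assms by (simp add: hol2_def)
  then obtain A B where AB: "open A" "open B" "(x0, y0) \<in> A \<times> B" "A \<times> B \<subseteq> S"
    using assms(2) by (rule open_prod_elim)
  obtain r where r: "r > 0" "cball x0 r \<subseteq> A" using AB open_contains_cball by blast
  obtain s where s: "s > 0" "cball y0 s \<subseteq> B" using AB open_contains_cball by blast
  have "cball x0 (min r s) \<times> cball y0 (min r s) \<subseteq> S"
    by (rule order.trans[OF Sigma_mono AB(4)]) (use r(2) s(2) in auto)
  then show ?thesis using r s by (intro that[of "min r s"]) auto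
qed

lemma hol2_D:
  assumes "hol2 f S" "(x, y) \<in> S"
  shows "((\<lambda>x. f x y) has_field_derivative deriv (\<lambda>x. f x y) x) (at x)"
    and "(f x has_field_derivative deriv (f x) y) (at y)"
  using assms open_slices[of S] unfolding hol2_def by (auto intro!: holomorphic_derivI)

text \<open>Uniform continuity on a compact box makes the slices \<open>f x\<close> and
  \<open>f x0\<close> uniformly close, and Cauchy's inequality passes this on to their derivatives.
  The change in y concerns only the single holomorphic slice \<open>f x0\<close>.\<close>

lemma hol2_deriv_snd_continuous:
  assumes f: "hol2 f S"
  shows "continuous_on S (\<lambda>(x, y). deriv (f x) y)"
proof -
  have oS: "open S" and cf: "continuous_on S (\<lambda>(x, y). f x y)"
    and hy: "\<And>x. f x holomorphic_on {y. (x, y) \<in> S}" using f by (auto simp: hol2_def)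
  have "isCont (\<lambda>(x, y). deriv (f x) y) (x0, y0)" if z: "(x0, y0) \<in> S" for x0 y0
  proof -
    obtain R where R: "R > 0" "cball x0 R \<times> cball y0 R \<subseteq> S"
      using hol2_box[OF f z] .
    have hb: "f x holomorphic_on cball y0 R" if "x \<in> cball x0 R" for x
      by (rule holomorphic_on_subset[OF hy]) (use R that in auto)
    have uc: "uniformly_continuous_on (cball x0 R \<times> cball y0 R) (\<lambda>(x, y). f x y)"
      by (intro compact_uniformly_continuous continuous_on_subset[OF cf] R compact_Times compact_cball)
    have cd: "isCont (deriv (f x0)) y0"
      using holomorphic_deriv[OF hy open_slices(2)[OF oS]] z open_slices(2)[OF oS]
      by (metis (no_types, lifting) continuous_on_eq_continuous_at holomorphic_on_imp_continuous_on mem_Collect_eq)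
    show ?thesis unfolding continuous_at_eps_delta
    proof (intro allI impI)
      fix e :: real assume e: "e > 0"
      obtain d1 where d1: "d1 > 0"
        "\<And>y. dist y y0 < d1 \<Longrightarrow> dist (deriv (f x0) y) (deriv (f x0) y0) < e / 2"
        using cd e unfolding continuous_at_eps_delta by (metis half_gt_zero)
      \<comment> \<open>Cauchy's inequality on a circle of radius R / 2 multiplies a bound by 2 / R,
        so e * R / 4 becomes e / 2.\<close>
      have "e * R / 4 > 0" using e R by simp
      then obtain d2 where d2: "d2 > 0"
        "\<And>z z'. z \<in> cball x0 R \<times> cball y0 R \<Longrightarrow> z' \<in> cball x0 R \<times> cball y0 R \<Longrightarrow> dist z' z < d2 \<Longrightarrow>
          dist ((\<lambda>(x, y). f x y) z') ((\<lambda>(x, y). f x y) z) < e * R / 4"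
        using uc unfolding uniformly_continuous_on_def by metis
      define d where "d = min (min d1 d2) (R / 2)"
      have dpos: "d > 0" using d1 d2 R by (simp add: d_def)
      have "dist (deriv (f x) y) (deriv (f x0) y0) < e" if xy: "dist (x, y) (x0, y0) < d" for x y
      proof -
        have dx: "dist x x0 < d" and dy: "dist y y0 < d"
          using xy dist_fst_le[of "(x, y)" "(x0, y0)"] dist_snd_le[of "(x, y)" "(x0, y0)"] by auto
        have xR: "x \<in> cball x0 R" "x0 \<in> cball x0 R" using dx R by (auto simp: d_def dist_commute)
        have sub: "cball y (R / 2) \<subseteq> cball y0 R"
          using dy R by (intro cball_subset_cball_iff[THEN iffD2]) (auto simp: d_def)
        define g where "g = (\<lambda>w. f x w - f x0 w)"
        have hg: "g holomorphic_on cball y (R / 2)"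
          unfolding g_def by (intro holomorphic_intros holomorphic_on_subset[OF hb sub] xR)
        have "norm ((deriv ^^ 1) g y) \<le> fact 1 * (e * R / 4) / (R / 2) ^ 1"
        proof (rule Cauchy_inequality)
          show "g holomorphic_on ball y (R / 2)"
            by (rule holomorphic_on_subset[OF hg]) auto
          show "continuous_on (cball y (R / 2)) g"
            by (rule holomorphic_on_imp_continuous_on[OF hg])
          fix w assume "norm (y - w) = R / 2"
          then have "w \<in> cball y0 R" using sub by (auto simp: dist_norm)
          then show "norm (g w) \<le> e * R / 4"
            using d2(2)[of "(x0, w)" "(x, w)"] xR dx unfolding g_def
            by (auto simp: dist_Pair_Pair d_def dist_norm)
        qed (use R in auto)
        then have 1: "norm (deriv g y) \<le> e / 2" using R by (simp add: field_simps)
        have yb: "y \<in> interior (cball y0 R)" using dy R by (auto simp: d_def dist_commute interior_cball)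
        have "deriv g y = deriv (f x) y - deriv (f x0) y" unfolding g_def
          by (intro deriv_diff holomorphic_on_imp_differentiable_at[OF holomorphic_on_subset[OF hb interior_subset]])
             (use xR yb in auto)
        then have "dist (deriv (f x) y) (deriv (f x0) y) \<le> e / 2" using 1 by (simp add: dist_norm)
        moreover have "dist (deriv (f x0) y) (deriv (f x0) y0) < e / 2" using d1 dy by (simp add: d_def)
        ultimately show ?thesis by (smt (verit) dist_triangle field_sum_of_halves)
      qed
      then show "\<exists>d>0. \<forall>z. dist z (x0, y0) < d \<longrightarrow>
          dist ((\<lambda>(x, y). deriv (f x) y) z) ((\<lambda>(x, y). deriv (f x) y) (x0, y0)) < e"
        using dpos by (intro exI[of _ d]) auto
    qed
  qed
  then show ?thesis by (auto intro!: continuous_at_imp_continuous_on)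
qed

text \<open>Holomorphy in x holds because the derivative in y is a locally uniform limit of
  difference quotients, each of which is holomorphic in x.\<close>

lemma hol2_deriv_snd:
  assumes f: "hol2 f S"
  shows "hol2 (\<lambda>x y. deriv (f x) y) S"
proof -
  have oS: "open S" and hx: "\<And>y. (\<lambda>x. f x y) holomorphic_on {x. (x, y) \<in> S}"
    and hy: "\<And>x. f x holomorphic_on {y. (x, y) \<in> S}" using f by (auto simp: hol2_def)
  have "(\<lambda>x. deriv (f x) y0) holomorphic_on {x. (x, y0) \<in> S}" for y0
  proof (rule holomorphic_on_open[THEN iffD2, rule_format])
    show "open {x. (x, y0) \<in> S}" by (rule open_slices[OF oS])
    fix x0 assume "x0 \<in> {x. (x, y0) \<in> S}"
    then have z: "(x0, y0) \<in> S" by simp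
    obtain R where R: "R > 0" "cball x0 R \<times> cball y0 R \<subseteq> S"
      using hol2_box[OF f z] .
    have uc: "uniformly_continuous_on (cball x0 R \<times> cball y0 R) (\<lambda>(x, y). deriv (f x) y)"
      by (intro compact_uniformly_continuous continuous_on_subset[OF hol2_deriv_snd_continuous[OF f]]
          R compact_Times compact_cball)
    define h where "h n = complex_of_real (R / (real n + 1))" for n :: nat
    have hn: "h n \<noteq> 0" "norm (h n) \<le> R" for n
      using R by (auto simp: h_def norm_divide field_simps simp del: of_real_add of_real_divide)
    define D where "D n x = (f x (y0 + h n) - f x y0) / h n" for n x
    have "(\<lambda>x. deriv (f x) y0) holomorphic_on ball x0 R"
    proof (rule holomorphic_uniform_sequence[of _ D])
      show "D n holomorphic_on ball x0 R" for n
      proof -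
        have "y0 + h n \<in> cball y0 R" "y0 \<in> cball y0 R" using hn R by (auto simp: dist_norm)
        then show ?thesis unfolding D_def
          by (intro holomorphic_intros holomorphic_on_subset[OF hx]) (use R hn in auto)
      qed
      fix x assume "x \<in> ball x0 R"
      then obtain d where d: "d > 0" "cball x d \<subseteq> ball x0 R"
        using open_contains_cball by blast
      have "uniform_limit (cball x d) D (\<lambda>x. deriv (f x) y0) sequentially"
      proof (rule uniform_limitI)
        fix e :: real assume e: "e > 0"
        then have "e / 2 > 0" by simp
        then obtain k where k: "k > 0"
          "\<And>z z'. z \<in> cball x0 R \<times> cball y0 R \<Longrightarrow> z' \<in> cball x0 R \<times> cball y0 R \<Longrightarrow> dist z' z < k \<Longrightarrow>
            dist ((\<lambda>(x, y). deriv (f x) y) z') ((\<lambda>(x, y). deriv (f x) y) z) < e / 2"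
          using uc unfolding uniformly_continuous_on_def by metis
        have "(\<lambda>n. R / (real n + 1)) \<longlonglongrightarrow> 0" by real_asymp
        then have "\<forall>\<^sub>F n in sequentially. R / (real n + 1) < k"
          using k(1) by (rule order_tendstoD)
        then show "\<forall>\<^sub>F n in sequentially. \<forall>x\<in>cball x d. dist (D n x) (deriv (f x) y0) < e"
        proof (eventually_elim, intro ballI)
          fix n x' assume n: "R / (real n + 1) < k" and "x' \<in> cball x d"
          then have x': "x' \<in> cball x0 R" using d by auto
          have nh: "norm (h n) < k" using n R by (simp add: h_def norm_divide del: of_real_add of_real_divide)
          \<comment> \<open>With the linear part removed, the derivative of \<open>g\<close> is the
            oscillation of \<open>deriv (f x')\<close> near \<open>y0\<close>, small uniformly in
            \<open>x'\<close>; the mean value inequality then bounds the error of the difference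
            quotient.\<close>
          define g where "g w = f x' w - deriv (f x') y0 * w" for w
          have "norm (g (y0 + h n) - g y0) \<le> e / 2 * norm (y0 + h n - y0)"
          proof (rule field_differentiable_bound)
            fix w assume w: "w \<in> cball y0 (norm (h n))"
            then have wS: "w \<in> cball y0 R" using hn(2)[of n] by auto
            then have "(x', w) \<in> S" using R x' by auto
            from hol2_D(2)[OF f this]
            show "(g has_field_derivative (deriv (f x') w - deriv (f x') y0)) (at w within cball y0 (norm (h n)))"
              unfolding g_def by (auto intro!: derivative_eq_intros intro: DERIV_subset)
            show "norm (deriv (f x') w - deriv (f x') y0) \<le> e / 2"
              using k(2)[of "(x', y0)" "(x', w)"] wS x' w R nh
              by (auto simp: dist_Pair_Pair dist_norm norm_minus_commute)
          qed (auto simp: dist_norm)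
          moreover have "g (y0 + h n) - g y0 = (D n x' - deriv (f x') y0) * h n"
            using hn(1)[of n] by (simp add: D_def g_def field_simps)
          ultimately have "norm (D n x' - deriv (f x') y0) \<le> e / 2"
            using hn(1)[of n] by (simp add: norm_mult)
          then show "dist (D n x') (deriv (f x') y0) < e" using e by (simp add: dist_norm)
        qed
      qed
      then show "\<exists>d>0. cball x d \<subseteq> ball x0 R \<and> uniform_limit (cball x d) D (\<lambda>x. deriv (f x) y0) sequentially"
        using d by blast
    qed auto
    then show "\<exists>f'. ((\<lambda>x. deriv (f x) y0) has_field_derivative f') (at x0)"
      using R by (meson centre_in_ball holomorphic_derivI open_ball)
  qed
  moreover have "deriv (f x) holomorphic_on {y. (x, y) \<in> S}" for x
    by (intro holomorphic_deriv hy open_slices oS)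
  ultimately show ?thesis using oS hol2_deriv_snd_continuous[OF f] by (auto simp: hol2_def)
qed

lemma hol2_deriv_fst:
  assumes f: "hol2 f S"
  shows "hol2 (\<lambda>x y. deriv (\<lambda>x. f x y) x) S"
  using hol2_swap[OF hol2_deriv_snd[OF hol2_swap[OF f]]] by simp

text \<open>Total differentiability follows from one partial derivative at the point and joint
  continuity of the other. The rule is made for maps such as q -> f(q^2 x, q), where q enters both
  arguments.\<close>

lemma hol2_chain:
  assumes f: "hol2 f S" and S: "(u t, v t) \<in> S"
    and u: "(u has_field_derivative u') (at t)" and v: "(v has_field_derivative v') (at t)"
  shows "((\<lambda>t. f (u t) (v t)) has_field_derivative
      deriv (\<lambda>x. f x (v t)) (u t) * u' + deriv (f (u t)) (v t) * v') (at t)"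
proof -
  obtain R where R: "R > 0" "cball (u t) R \<times> cball (v t) R \<subseteq> S" using hol2_box[OF f S] .
  let ?X = "ball (u t) R" and ?Y = "ball (v t) R"
  have sub: "?X \<times> ?Y \<subseteq> S" using R by auto
  have "((\<lambda>(x, y). f x y) has_derivative
      (\<lambda>(h, k). deriv (\<lambda>x. f x (v t)) (u t) * h + blinfun_mult_right (deriv (f (u t)) (v t)) k))
      (at (u t, v t) within ?X \<times> ?Y)"
  proof (rule has_derivative_partialsI[where fy = "\<lambda>x y. blinfun_mult_right (deriv (f x) y)"])
    show "((\<lambda>x. f x (v t)) has_derivative (*) (deriv (\<lambda>x. f x (v t)) (u t))) (at (u t) within ?X)"
      using hol2_D(1)[OF f S] by (simp add: has_field_derivative_def has_derivative_at_withinI)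
    show "(f x has_derivative blinfun_apply (blinfun_mult_right (deriv (f x) y))) (at y within ?Y)"
      if "x \<in> ?X" "y \<in> ?Y" for x y
    proof -
      have "(x, y) \<in> S" using sub that by auto
      from hol2_D(2)[OF f this] show ?thesis
        by (simp add: has_field_derivative_def has_derivative_at_withinI)
    qed
    have "continuous_on (?X \<times> ?Y) (\<lambda>(x, y). deriv (f x) y)"
      by (rule continuous_on_subset[OF hol2_deriv_snd_continuous[OF f] sub])
    then have "continuous_on (?X \<times> ?Y) (\<lambda>z. blinfun_mult_right ((\<lambda>(x, y). deriv (f x) y) z))"
      by (rule bounded_linear.continuous_on[OF bounded_linear_blinfun_mult_right])
    then show "continuous (at (u t, v t) within ?X \<times> ?Y) (\<lambda>(x, y). blinfun_mult_right (deriv (f x) y))"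
      using R(1) by (auto simp: continuous_on_eq_continuous_within case_prod_unfold)
  qed (use R in auto)
  moreover have "at (u t, v t) within ?X \<times> ?Y = at (u t, v t)"
    using R(1) by (intro at_within_open open_Times) auto
  ultimately have d: "((\<lambda>(x, y). f x y) has_derivative
      (\<lambda>(h, k). deriv (\<lambda>x. f x (v t)) (u t) * h + deriv (f (u t)) (v t) * k)) (at (u t, v t))"
    by simp
  have "((\<lambda>t. (u t, v t)) has_derivative (\<lambda>h. (u' * h, v' * h))) (at t)"
    using u v by (auto simp: has_field_derivative_def intro!: has_derivative_Pair)
  from has_derivative_compose[OF this d]
  have "((\<lambda>t. f (u t) (v t)) has_derivative (\<lambda>h. deriv (\<lambda>x. f x (v t)) (u t) * (u' * h) +
      deriv (f (u t)) (v t) * (v' * h))) (at t)" by simp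
  then show ?thesis unfolding has_field_derivative_def
    by (rule has_derivative_eq_rhs) (auto simp: algebra_simps)
qed

section \<open>Closure properties of joint holomorphy\<close>

lemma hol2_const: "open S \<Longrightarrow> hol2 (\<lambda>x y. c) S"
  by (auto simp: hol2_def case_prod_unfold)

lemma hol2_fst: "open S \<Longrightarrow> hol2 (\<lambda>x y. x) S"
  and hol2_snd: "open S \<Longrightarrow> hol2 (\<lambda>x y. y) S"
  by (auto simp: hol2_def case_prod_unfold intro!: continuous_intros holomorphic_intros)

lemma hol2_add: "hol2 f S \<Longrightarrow> hol2 g S \<Longrightarrow> hol2 (\<lambda>x y. f x y + g x y) S"
  and hol2_diff: "hol2 f S \<Longrightarrow> hol2 g S \<Longrightarrow> hol2 (\<lambda>x y. f x y - g x y) S"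
  and hol2_mult: "hol2 f S \<Longrightarrow> hol2 g S \<Longrightarrow> hol2 (\<lambda>x y. f x y * g x y) S"
  by (auto simp: hol2_def case_prod_unfold intro!: continuous_intros holomorphic_intros)

lemma hol2_minus: "hol2 f S \<Longrightarrow> hol2 (\<lambda>x y. - f x y) S"
  by (auto simp: hol2_def case_prod_unfold intro!: continuous_intros holomorphic_intros)

lemma hol2_power: "hol2 f S \<Longrightarrow> hol2 (\<lambda>x y. f x y ^ n) S"
  by (auto simp: hol2_def case_prod_unfold intro!: continuous_intros holomorphic_intros)

lemma hol2_divide:
  "hol2 f S \<Longrightarrow> hol2 g S \<Longrightarrow> (\<And>x y. (x, y) \<in> S \<Longrightarrow> g x y \<noteq> 0) \<Longrightarrow> hol2 (\<lambda>x y. f x y / g x y) S"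
  by (auto simp: hol2_def case_prod_unfold intro!: continuous_intros holomorphic_intros)

lemma hol2_prod:
  assumes "open S" "\<And>i. i \<in> I \<Longrightarrow> hol2 (f i) S"
  shows "hol2 (\<lambda>x y. \<Prod>i\<in>I. f i x y) S"
  using assms by (induction I rule: infinite_finite_induct) (auto intro: hol2_const hol2_mult)

lemma hol2_sum:
  assumes "open S" "\<And>i. i \<in> I \<Longrightarrow> hol2 (f i) S"
  shows "hol2 (\<lambda>x y. \<Sum>i\<in>I. f i x y) S"
  using assms by (induction I rule: infinite_finite_induct) (auto intro: hol2_const hol2_add)

lemma hol2_subset:
  assumes "hol2 f S" "open T" "T \<subseteq> S"
  shows "hol2 f T"
proof -
  have "{x. (x, y) \<in> T} \<subseteq> {x. (x, y) \<in> S}" "{y. (x, y) \<in> T} \<subseteq> {y. (x, y) \<in> S}" for x y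
    using assms(3) by auto
  then show ?thesis using assms unfolding hol2_def
    by (meson continuous_on_subset holomorphic_on_subset)
qed

lemma hol2_cong:
  assumes "hol2 f S" "\<And>x y. (x, y) \<in> S \<Longrightarrow> f x y = g x y"
  shows "hol2 g S"
proof -
  have "continuous_on S (\<lambda>(x, y). g x y)"
    using assms by (auto simp: hol2_def elim!: continuous_on_eq)
  moreover have "(\<lambda>x. g x y) holomorphic_on {x. (x, y) \<in> S}" "g x holomorphic_on {y. (x, y) \<in> S}" for x y
    using assms by (auto simp: hol2_def intro: holomorphic_transform[of "\<lambda>x. f x y"] holomorphic_transform[of "f x"])
  ultimately show ?thesis using assms(1) by (simp add: hol2_def)
qed

lemma hol2_compose:
  assumes f: "hol2 f T" and g: "hol2 g S" and h: "hol2 h S"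
    and ST: "\<And>x y. (x, y) \<in> S \<Longrightarrow> (g x y, h x y) \<in> T"
  shows "hol2 (\<lambda>x y. f (g x y) (h x y)) S"
proof -
  have oS: "open S" using g by (simp add: hol2_def)
  have cf: "continuous_on T (\<lambda>(x, y). f x y)" using f by (simp add: hol2_def)
  have cgh: "continuous_on S (\<lambda>z. (g (fst z) (snd z), h (fst z) (snd z)))"
    using g h by (intro continuous_on_Pair) (simp_all add: hol2_def case_prod_unfold)
  have "continuous_on S (\<lambda>z. (\<lambda>(x, y). f x y) (g (fst z) (snd z), h (fst z) (snd z)))"
    by (rule continuous_on_compose2[OF cf cgh]) (use ST in auto)
  moreover have "(\<lambda>x. f (g x y) (h x y)) holomorphic_on {x. (x, y) \<in> S}" for y
    unfolding holomorphic_on_open[OF open_slices(1)[OF oS]]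
  proof safe
    fix x assume z: "(x, y) \<in> S"
    from hol2_chain[OF f ST[OF z] hol2_D(1)[OF g z] hol2_D(1)[OF h z]]
    show "\<exists>f'. ((\<lambda>x. f (g x y) (h x y)) has_field_derivative f') (at x)" by blast
  qed
  moreover have "(\<lambda>y. f (g x y) (h x y)) holomorphic_on {y. (x, y) \<in> S}" for x
    unfolding holomorphic_on_open[OF open_slices(2)[OF oS]]
  proof safe
    fix y assume z: "(x, y) \<in> S"
    from hol2_chain[OF f ST[OF z] hol2_D(2)[OF g z] hol2_D(2)[OF h z]]
    show "\<exists>f'. ((\<lambda>y. f (g x y) (h x y)) has_field_derivative f') (at y)" by blast
  qed
  ultimately show ?thesis using oS by (auto simp: hol2_def case_prod_unfold)
qed

lemma hol2_uniform_limit: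
  assumes S: "open S" and f: "\<And>n. hol2 (f n) S"
    and lim: "\<And>z. z \<in> S \<Longrightarrow> \<exists>d>0. cball z d \<subseteq> S \<and>
      uniform_limit (cball z d) (\<lambda>n (x, y). f n x y) (\<lambda>(x, y). g x y) sequentially"
  shows "hol2 g S"
proof -
  have "continuous_on S (\<lambda>(x, y). g x y)"
  proof (rule continuous_at_imp_continuous_on, rule ballI)
    fix z assume "z \<in> S"
    then obtain d where d: "d > 0" "cball z d \<subseteq> S"
      "uniform_limit (cball z d) (\<lambda>n (x, y). f n x y) (\<lambda>(x, y). g x y) sequentially"
      using lim by blast
    have "continuous_on (cball z d) (\<lambda>(x, y). g x y)"
    proof (rule uniform_limit_theorem[OF _ d(3)])
      have "continuous_on (cball z d) (\<lambda>(x, y). f n x y)" for n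
        using f[of n] d(2) by (auto simp: hol2_def elim: continuous_on_subset)
      then show "\<forall>\<^sub>F n in sequentially. continuous_on (cball z d) (\<lambda>(x, y). f n x y)" by simp
    qed simp
    then show "isCont (\<lambda>(x, y). g x y) z"
      using d(1) by (simp add: continuous_on_interior interior_cball)
  qed
  moreover have "(\<lambda>x. g x y) holomorphic_on {x. (x, y) \<in> S}" for y
  proof (rule holomorphic_uniform_sequence[OF open_slices(1)[OF S], of "\<lambda>n x. f n x y"])
    fix x assume "x \<in> {x. (x, y) \<in> S}"
    then obtain d where d: "d > 0" "cball (x, y) d \<subseteq> S"
      "uniform_limit (cball (x, y) d) (\<lambda>n (x, y). f n x y) (\<lambda>(x, y). g x y) sequentially"
      using lim[of "(x, y)"] by blast
    have m: "(w, y) \<in> cball (x, y) d" if "w \<in> cball x d" for w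
      using that by (simp add: dist_Pair_Pair)
    then have "uniform_limit (cball x d) (\<lambda>n x. f n x y) (\<lambda>x. g x y) sequentially"
      using uniform_limit_compose'[OF d(3), of "\<lambda>x. (x, y)" "cball x d"] m by (simp add: Pi_iff)
    then show "\<exists>d>0. cball x d \<subseteq> {x. (x, y) \<in> S} \<and> uniform_limit (cball x d) (\<lambda>n x. f n x y) (\<lambda>x. g x y) sequentially"
      using d(1,2) m by blast
  qed (use f in \<open>auto simp: hol2_def\<close>)
  moreover have "g x holomorphic_on {y. (x, y) \<in> S}" for x
  proof (rule holomorphic_uniform_sequence[OF open_slices(2)[OF S], of "\<lambda>n. f n x"])
    fix y assume "y \<in> {y. (x, y) \<in> S}"
    then obtain d where d: "d > 0" "cball (x, y) d \<subseteq> S"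
      "uniform_limit (cball (x, y) d) (\<lambda>n (x, y). f n x y) (\<lambda>(x, y). g x y) sequentially"
      using lim[of "(x, y)"] by blast
    have m: "(x, w) \<in> cball (x, y) d" if "w \<in> cball y d" for w
      using that by (simp add: dist_Pair_Pair)
    then have "uniform_limit (cball y d) (\<lambda>n. f n x) (g x) sequentially"
      using uniform_limit_compose'[OF d(3), of "\<lambda>y. (x, y)" "cball y d"] m by (simp add: Pi_iff)
    then show "\<exists>d>0. cball y d \<subseteq> {y. (x, y) \<in> S} \<and> uniform_limit (cball y d) (\<lambda>n. f n x) (g x) sequentially"
      using d(1,2) m by blast
  qed (use f in \<open>auto simp: hol2_def\<close>)
  ultimately show ?thesis using S by (simp add: hol2_def)
qed

subsection \<open>Infinite q-products\<close>

text \<open>The finite product that \<open>qpoch\<close> encodes as a quotient of infinite ones; it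
  keeps its meaning when a tail product vanishes.\<close>

definition qfin :: "complex \<Rightarrow> complex \<Rightarrow> nat \<Rightarrow> complex" where
  "qfin a p n = (\<Prod>t<n. 1 - a * p ^ t)"

abbreviation (input) qinf :: "complex \<Rightarrow> complex \<Rightarrow> complex" where
  "qinf a p \<equiv> qpoch_inf [a] p"

lemma qfin_0 [simp]: "qfin a p 0 = 1"
  and qfin_Suc: "qfin a p (Suc n) = qfin a p n * (1 - a * p ^ n)"
  by (simp_all add: qfin_def)

lemma qfin_add: "qfin a p (m + n) = qfin a p m * qfin (a * p ^ m) p n"
  by (induction n) (simp_all add: qfin_Suc power_add mult_ac)

lemma convergent_qprod:
  fixes a p :: complex
  assumes "norm p < 1"
  shows "convergent_prod (\<lambda>t. 1 - a * p ^ t)"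
proof -
  have "summable (\<lambda>t. norm a * norm p ^ t)"
    using assms by (intro summable_mult summable_geometric) simp
  moreover have "(\<lambda>t. norm (1 - a * p ^ t - 1)) = (\<lambda>t. norm a * norm p ^ t)"
    by (simp add: norm_mult norm_power)
  ultimately have "summable (\<lambda>t. norm (1 - a * p ^ t - 1))" by (simp only:)
  then have "abs_convergent_prod (\<lambda>t. 1 - a * p ^ t)"
    by (simp only: abs_convergent_prod_conv_summable)
  then show ?thesis by (rule abs_convergent_prod_imp_convergent_prod)
qed

lemma qinf_eq: "qinf a p = (\<Prod>t. 1 - a * p ^ t)"
  by (simp add: qpoch_inf_def)

lemma qfin_tendsto:
  assumes "norm p < 1"
  shows "qfin a p \<longlonglongrightarrow> qinf a p"
  using convergent_prod_LIMSEQ[OF convergent_qprod[OF assms, of a]]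
  unfolding qinf_eq qfin_def LIMSEQ_lessThan_iff_atMost[where f = "\<lambda>A. prod _ A"] .

lemma qpoch_inf_pair:
  assumes "norm p < 1"
  shows "qpoch_inf [a, b] p = qinf a p * qinf b p"
  using prodinf_mult[OF convergent_qprod[OF assms, of a] convergent_qprod[OF assms, of b]]
  by (simp add: qpoch_inf_def)

lemma qinf_split:
  assumes "norm p < 1"
  shows "qinf a p = qfin a p n * qinf (a * p ^ n) p"
proof (rule LIMSEQ_unique)
  show "(\<lambda>m. qfin a p (n + m)) \<longlonglongrightarrow> qinf a p"
    using LIMSEQ_ignore_initial_segment[OF qfin_tendsto[OF assms], of a n] by (simp add: add.commute)
  show "(\<lambda>m. qfin a p (n + m)) \<longlonglongrightarrow> qfin a p n * qinf (a * p ^ n) p"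
    unfolding qfin_add by (intro tendsto_intros qfin_tendsto assms)
qed

lemma qinf_rec: "norm p < 1 \<Longrightarrow> qinf a p = (1 - a) * qinf (a * p) p"
  using qinf_split[of p a 1] by (simp add: qfin_def)

text \<open>Convergence of a product includes a nonzero limit after finitely many factors are
  dropped, so the value can vanish only through a factor.\<close>

lemma qinf_eq_0_iff:
  assumes "norm p < 1"
  shows "qinf a p = 0 \<longleftrightarrow> (\<exists>t. a * p ^ t = 1)"
  using convergent_prod_to_zero_iff[OF convergent_qprod[OF assms, of a]]
    convergent_prod_LIMSEQ[OF convergent_qprod[OF assms, of a]]
  unfolding qinf_eq by (metis (lifting) LIMSEQ_unique eq_iff_diff_eq_0)

text \<open>From 1 + s \<le> exp s in each factor and a geometric sum. The bound is independent of
  n, as the majorants of the series below require.\<close>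

lemma norm_qfin_le:
  assumes "norm p < 1"
  shows "norm (qfin a p n) \<le> exp (norm a / (1 - norm p))"
proof -
  have "norm (qfin a p n) \<le> (\<Prod>t<n. exp (norm a * norm p ^ t))"
    unfolding qfin_def prod_norm[symmetric]
  proof (intro prod_mono conjI norm_ge_zero)
    fix t
    have "norm (1 - a * p ^ t) \<le> 1 + norm a * norm p ^ t"
      by (metis norm_mult norm_one norm_power norm_triangle_ineq4)
    also have "\<dots> \<le> exp (norm a * norm p ^ t)" by (rule exp_ge_add_one_self)
    finally show "norm (1 - a * p ^ t) \<le> exp (norm a * norm p ^ t)" .
  qed
  also have "\<dots> = exp (norm a * (\<Sum>t<n. norm p ^ t))"
    by (simp add: exp_sum sum_distrib_left)
  also have "\<dots> \<le> exp (norm a * (1 / (1 - norm p)))"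
  proof -
    have "(\<Sum>t<n. norm p ^ t) \<le> (\<Sum>t. norm p ^ t)"
      using assms by (intro sum_le_suminf summable_geometric) auto
    then have "(\<Sum>t<n. norm p ^ t) \<le> 1 / (1 - norm p)" using assms by (simp add: suminf_geometric)
    then have "norm a * (\<Sum>t<n. norm p ^ t) \<le> norm a * (1 / (1 - norm p))"
      by (rule mult_left_mono) simp
    then show ?thesis by (simp only: exp_le_cancel_iff)
  qed
  finally show ?thesis by simp
qed

lemma norm_qinf_le:
  assumes "norm p < 1"
  shows "norm (qinf a p) \<le> exp (norm a / (1 - norm p))"
  by (rule LIMSEQ_le_const2[OF tendsto_norm[OF qfin_tendsto[OF assms]]])
     (use norm_qfin_le[OF assms] in blast)

lemma qinf_square_base:
  assumes "norm p < 1"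
  shows "qinf a p = qinf a (p^2) * qinf (a * p) (p^2)"
proof (rule LIMSEQ_unique)
  have p2: "norm (p^2) < 1" using assms by (simp add: norm_power power_less_one_iff)
  show "(\<lambda>n. qfin a p (2 * n)) \<longlonglongrightarrow> qinf a p"
    using LIMSEQ_subseq_LIMSEQ[OF qfin_tendsto[OF assms], of "\<lambda>n. 2 * n"]
    by (simp add: strict_mono_def o_def)
  have "qfin a p (2 * n) = qfin a (p^2) n * qfin (a * p) (p^2) n" for n
    by (induction n) (simp_all add: qfin_Suc power_mult mult_ac flip: power_mult)
  then show "(\<lambda>n. qfin a p (2 * n)) \<longlonglongrightarrow> qinf a (p^2) * qinf (a * p) (p^2)"
    by (simp add: tendsto_mult qfin_tendsto p2)
qed

lemma qinf_square:
  assumes "norm p < 1"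
  shows "qinf a p * qinf (-a) p = qinf (a^2) (p^2)"
proof (rule LIMSEQ_unique)
  have p2: "norm (p^2) < 1" using assms by (simp add: norm_power power_less_one_iff)
  have "qfin a p n * qfin (-a) p n = qfin (a^2) (p^2) n" for n
    by (induction n) (simp_all add: qfin_Suc algebra_simps power2_eq_square flip: power_mult_distrib)
  then show "(\<lambda>n. qfin (a^2) (p^2) n) \<longlonglongrightarrow> qinf a p * qinf (-a) p"
    using tendsto_mult[OF qfin_tendsto[OF assms, of a] qfin_tendsto[OF assms, of "-a"]] by simp
qed (use assms in \<open>auto intro!: qfin_tendsto simp: norm_power power_less_one_iff\<close>)

lemma hol2_qfin:
  assumes "open S"
  shows "hol2 (\<lambda>a p. qfin a p n) S"
  unfolding qfin_def
  by (intro hol2_prod hol2_diff hol2_const hol2_mult hol2_power hol2_fst hol2_snd assms)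

lemma cball_UNIV_disc:
  fixes z :: "complex \<times> complex"
  assumes "z \<in> UNIV \<times> ball 0 1"
  obtains d R r where "d > 0" "cball z d \<subseteq> UNIV \<times> ball 0 1" "0 \<le> r" "r < 1"
    "\<And>x y. (x, y) \<in> cball z d \<Longrightarrow> norm x \<le> R \<and> norm y \<le> r"
proof -
  obtain x0 y0 where z: "z = (x0, y0)" by (cases z)
  have y0: "norm y0 < 1" using assms z by simp
  define d where "d = (1 - norm y0) / 2"
  have b: "norm x \<le> norm x0 + d \<and> norm y \<le> norm y0 + d" if "(x, y) \<in> cball z d" for x y
  proof -
    have "dist (x, y) (x0, y0) \<le> d" using that z by (simp add: dist_commute)
    then have "dist x x0 \<le> d" "dist y y0 \<le> d"
      using dist_fst_le[of "(x, y)" "(x0, y0)"] dist_snd_le[of "(x, y)" "(x0, y0)"] by auto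
    then show ?thesis
      using norm_triangle_ineq2[of x x0] norm_triangle_ineq2[of y y0] by (simp add: dist_norm)
  qed
  have "norm y0 + d < 1" "d > 0" using y0 by (auto simp: d_def field_simps)
  moreover from this b have "cball z d \<subseteq> UNIV \<times> ball 0 1" by (auto simp: subset_iff) force
  ultimately show ?thesis using b by (intro that[of d "norm y0 + d" "norm x0 + d"]) auto
qed

lemma hol2_qinf: "hol2 qinf (UNIV \<times> ball 0 1)"
proof (rule hol2_uniform_limit[where f = "\<lambda>n a p. qfin a p n"])
  show oS: "open (UNIV \<times> ball 0 1 :: (complex \<times> complex) set)" by (intro open_Times) auto
  show "hol2 (\<lambda>a p. qfin a p n) (UNIV \<times> ball 0 1)" for n by (rule hol2_qfin[OF oS])
  fix z :: "complex \<times> complex" assume "z \<in> UNIV \<times> ball 0 1"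
  then obtain d R r where d: "d > 0" "cball z d \<subseteq> UNIV \<times> ball 0 1" "0 \<le> r" "r < 1"
    "\<And>x y. (x, y) \<in> cball z d \<Longrightarrow> norm x \<le> R \<and> norm y \<le> r"
    using cball_UNIV_disc by metis
  have "uniformly_convergent_on (cball z d) (\<lambda>N w. \<Prod>n<N. 1 + - (fst w * snd w ^ n))"
  proof (rule uniformly_convergent_on_prod)
    show "uniformly_convergent_on (cball z d) (\<lambda>N x. \<Sum>n<N. norm (- (fst x * snd x ^ n)))"
    proof (rule Weierstrass_m_test'[where M = "\<lambda>n. R * r ^ n"])
      fix n w assume "w \<in> cball z d"
      then have "norm (fst w) \<le> R" "norm (snd w) \<le> r" using d(5)[of "fst w" "snd w"] by auto
      then show "norm (norm (- (fst w * snd w ^ n))) \<le> R * r ^ n"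
        by (auto simp: norm_mult norm_power intro!: mult_mono power_mono intro: order.trans[OF norm_ge_zero])
    qed (use d in \<open>auto intro!: summable_mult summable_geometric\<close>)
  qed (auto intro!: continuous_intros)
  then obtain l where l: "uniform_limit (cball z d) (\<lambda>N w. \<Prod>n<N. 1 + - (fst w * snd w ^ n)) l sequentially"
    unfolding uniformly_convergent_on_def by blast
  have "l w = qinf (fst w) (snd w)" if "w \<in> cball z d" for w
  proof (rule LIMSEQ_unique)
    show "qfin (fst w) (snd w) \<longlonglongrightarrow> l w"
      using tendsto_uniform_limitI[OF l that] by (simp add: qfin_def[abs_def])
    show "qfin (fst w) (snd w) \<longlonglongrightarrow> qinf (fst w) (snd w)"
      using d(5)[of "fst w" "snd w"] that d(4) by (intro qfin_tendsto) auto
  qed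
  then have "uniform_limit (cball z d) (\<lambda>n (x, y). qfin x y n) (\<lambda>(x, y). qinf x y) sequentially"
    using l by (subst (asm) uniform_limit_cong'[where g = "\<lambda>n (x, y). qfin x y n" and i = "\<lambda>(x, y). qinf x y"])
       (auto simp: qfin_def case_prod_unfold)
  then show "\<exists>d>0. cball z d \<subseteq> UNIV \<times> ball 0 1 \<and>
      uniform_limit (cball z d) (\<lambda>n (x, y). qfin x y n) (\<lambda>(x, y). qinf x y) sequentially"
    using d by blast
qed

lemma hol2_qinf_compose:
  assumes "hol2 g S" "hol2 h S" "\<And>x y. (x, y) \<in> S \<Longrightarrow> norm (h x y) < 1"
  shows "hol2 (\<lambda>x y. qinf (g x y) (h x y)) S"
  by (rule hol2_compose[OF hol2_qinf assms(1,2)]) (use assms(3) in auto)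

subsection \<open>The theta function\<close>

lemma J_fun_eq:
  assumes "norm p < 1"
  shows "J_fun z p = qinf z p * qinf (p / z) p"
  by (simp add: J_fun_def qpoch_inf_pair assms)

lemma J_fun_rec:
  assumes "norm p < 1"
  shows "J_fun z p = (1 - z) * (qinf (z * p) p * qinf (p / z) p)"
  by (simp add: J_fun_eq assms qinf_rec[of p z])

lemma J_fun_shift:
  assumes "norm p < 1" "p \<noteq> 0" "z \<noteq> 0"
  shows "J_fun (p * z) p = - J_fun z p / z"
proof -
  have "J_fun (p * z) p = qinf (z * p) p * qinf (1 / z) p"
    using assms by (simp add: J_fun_eq mult.commute)
  also have "qinf (1 / z) p = (1 - 1 / z) * qinf (p / z) p"
    using qinf_rec[of p "1 / z"] assms by simp
  finally show ?thesis using assms by (simp add: J_fun_rec field_simps)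
qed

lemma J_fun_inverse:
  assumes "norm p < 1" "z \<noteq> 0"
  shows "J_fun (1 / z) p = - J_fun z p / z"
  using assms by (simp add: J_fun_rec field_simps)

lemma J_fun_eq_0_cases:
  assumes "norm p < 1" "z \<noteq> 0" "J_fun z p = 0"
  obtains k where "p ^ k \<noteq> 0" "z = p ^ k \<or> z = 1 / p ^ k"
proof -
  consider t where "z * p ^ t = 1" | t where "p / z * p ^ t = 1"
    using assms(3) unfolding J_fun_eq[OF assms(1)] by (auto simp: qinf_eq_0_iff assms(1))
  then show ?thesis
  proof cases
    case 1
    then have "p ^ t \<noteq> 0" by (metis mult_zero_right zero_neq_one)
    moreover from this 1 have "z = 1 / p ^ t" by (metis nonzero_eq_divide_eq)
    ultimately show ?thesis using that by blast
  next
    case 2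
    then have "z = p ^ Suc t" using assms(2) by (simp add: field_simps)
    with assms(2) show ?thesis by (intro that[of "Suc t"]) auto
  qed
qed

lemma hol2_J_fun: "hol2 J_fun ((- {0}) \<times> ball 0 1)"
proof -
  have oS: "open ((- {0}) \<times> ball 0 1 :: (complex \<times> complex) set)" by (intro open_Times) auto
  show ?thesis
  proof (rule hol2_cong)
    show "hol2 (\<lambda>z p. qinf z p * qinf (p / z) p) ((- {0}) \<times> ball 0 1)"
      by (intro hol2_mult hol2_qinf_compose hol2_divide hol2_fst[OF oS] hol2_snd[OF oS]) auto
  qed (simp add: J_fun_eq)
qed

lemma J_fun_holomorphic:
  assumes "norm p < 1"
  shows "(\<lambda>z. J_fun z p) holomorphic_on - {0}"
proof -
  have "(\<lambda>z. J_fun z p) holomorphic_on {z. (z, p) \<in> (- {0}) \<times> ball 0 1}"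
    using hol2_J_fun unfolding hol2_def by blast
  then show ?thesis by (rule holomorphic_on_subset) (use assms in auto)
qed

lemma J_fun_has_deriv:
  assumes "norm p < 1" "z \<noteq> 0"
  shows "((\<lambda>z. J_fun z p) has_field_derivative deriv (\<lambda>z. J_fun z p) z) (at z)"
  by (rule holomorphic_derivI[OF J_fun_holomorphic[OF assms(1)]]) (use assms in auto)

lemma J_fun_1 [simp]: "norm p < 1 \<Longrightarrow> J_fun 1 p = 0"
  by (simp add: J_fun_rec)

lemma qinf_self_neq_0:
  assumes "norm p < 1"
  shows "qinf p p \<noteq> 0"
proof -
  have "norm (p * p ^ t) < 1" for t
    using power_Suc_less_one[of "norm p" t] assms
    by (cases "p = 0") (simp_all add: norm_mult norm_power)
  then have "p * p ^ t \<noteq> 1" for t by (metis norm_one order_less_irrefl)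
  then show ?thesis by (simp add: qinf_eq_0_iff assms)
qed

text \<open>The factor 1 - z splits off, so the derivative at its zero is minus the cofactor
  there.\<close>

lemma J_fun_deriv_1:
  assumes "norm p < 1"
  shows "deriv (\<lambda>z. J_fun z p) 1 = - ((qinf p p)^2)"
proof -
  define g where "g = (\<lambda>z. qinf (z * p) p * qinf (p / z) p)"
  have "hol2 (\<lambda>z p. qinf (z * p) p * qinf (p / z) p) ((- {0}) \<times> ball 0 1)"
    by (intro hol2_mult hol2_qinf_compose hol2_divide hol2_fst hol2_snd open_Times) auto
  from hol2_D(1)[OF this, of 1 p] have "(g has_field_derivative deriv g 1) (at 1)"
    using assms by (simp add: g_def)
  then have "((\<lambda>z. (1 - z) * g z) has_field_derivative - g 1) (at 1)"
    by (auto intro!: derivative_eq_intros)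
  moreover have "(\<lambda>z. J_fun z p) = (\<lambda>z. (1 - z) * g z)"
    using assms by (simp add: fun_eq_iff J_fun_rec g_def)
  ultimately show ?thesis by (metis DERIV_imp_deriv g_def div_by_1 mult_1 power2_eq_square)
qed

text \<open>Differentiate J(p z) = - J(z) / z: at a zero the term from the derivative of 1 / z drops
  out. Simplicity of a zero thus travels along z -> p z.\<close>

lemma J_fun_deriv_shift:
  assumes "norm p < 1" "p \<noteq> 0" "z \<noteq> 0" "J_fun z p = 0"
  shows "p * deriv (\<lambda>z. J_fun z p) (p * z) = - deriv (\<lambda>z. J_fun z p) z / z"
proof (rule DERIV_unique)
  have "((\<lambda>z. J_fun (p * z) p) has_field_derivative deriv (\<lambda>z. J_fun z p) (p * z) * p) (at z)"
    by (rule DERIV_chain2[OF J_fun_has_deriv]) (use assms in \<open>auto intro!: derivative_eq_intros\<close>)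
  then show "((\<lambda>z. J_fun (p * z) p) has_field_derivative p * deriv (\<lambda>z. J_fun z p) (p * z)) (at z)"
    by (simp add: mult.commute)
  have "((\<lambda>z. - J_fun z p / z) has_field_derivative
      (- deriv (\<lambda>z. J_fun z p) z * z - (- J_fun z p) * 1) / (z * z)) (at z)"
    by (intro DERIV_divide DERIV_minus J_fun_has_deriv DERIV_ident assms(1,3))
  then have 1: "((\<lambda>z. - J_fun z p / z) has_field_derivative - deriv (\<lambda>z. J_fun z p) z / z) (at z)"
    using assms(3,4) by simp
  have 2: "\<forall>\<^sub>F w in nhds z. - J_fun w p / w = J_fun (p * w) p"
    using assms by (intro eventually_nhds_in_open[THEN eventually_mono, of "- {0}"]) (auto simp: J_fun_shift)
  show "((\<lambda>z. J_fun (p * z) p) has_field_derivative - deriv (\<lambda>z. J_fun z p) z / z) (at z)"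
    using 1 DERIV_cong_ev[OF refl 2 refl] by (rule iffD1[rotated])
qed

text \<open>All zeros are integer powers of p. The derivative at 1 is known, and the shift relation
  carries its nonvanishing to positive and negative powers.\<close>

lemma J_fun_simple_zero:
  assumes p: "norm p < 1" "p \<noteq> 0" and z: "z \<noteq> 0" "J_fun z p = 0"
  shows "deriv (\<lambda>z. J_fun z p) z \<noteq> 0"
proof -
  let ?D = "deriv (\<lambda>z. J_fun z p)"
  have up: "J_fun (p ^ k) p = 0 \<and> ?D (p ^ k) \<noteq> 0" for k
  proof (induction k)
    case 0
    then show ?case using p qinf_self_neq_0 by (simp add: J_fun_deriv_1)
  next
    case (Suc k)
    then show ?case
      using p J_fun_shift[of p "p ^ k"] J_fun_deriv_shift[of p "p ^ k"] by auto
  qed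
  have down: "J_fun (1 / p ^ k) p = 0 \<and> ?D (1 / p ^ k) \<noteq> 0" for k
  proof (induction k)
    case 0
    then show ?case using up[of 0] by simp
  next
    case (Suc k)
    have eq: "p * (1 / p ^ Suc k) = 1 / p ^ k" using p by simp
    have "J_fun (1 / p ^ Suc k) p = 0"
      using p J_fun_shift[of p "1 / p ^ Suc k"] Suc unfolding eq by simp
    then show ?case
      using p J_fun_deriv_shift[of p "1 / p ^ Suc k"] Suc unfolding eq by auto
  qed
  from J_fun_eq_0_cases[OF p(1) z] show ?thesis using up down by metis
qed

subsection \<open>Uniqueness of quasi-periodic functions\<close>

lemma holomorphic_quotient_simple_zeros:
  assumes S: "open S" and f: "f holomorphic_on S" and g: "g holomorphic_on S"
    and zero: "\<And>z. z \<in> S \<Longrightarrow> g z = 0 \<Longrightarrow> f z = 0 \<and> deriv g z \<noteq> 0"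
  obtains h where "h holomorphic_on S" "\<And>z. z \<in> S \<Longrightarrow> f z = g z * h z"
proof -
  \<comment> \<open>At a zero of \<open>g\<close> the value is the limit of f / g given by
    l'Hopital's rule, so the singularity is removable.\<close>
  define h where "h z = (if g z = 0 then deriv f z / deriv g z else f z / g z)" for z
  have "\<exists>h'. (h has_field_derivative h') (at a)" if a: "a \<in> S" for a
  proof (cases "g a = 0")
    case False
    have "open (S \<inter> g -` (- {0}))"
      by (intro continuous_open_preimage holomorphic_on_imp_continuous_on g S) auto
    then have "\<forall>\<^sub>F z in nhds a. z \<in> S \<inter> g -` (- {0})"
      by (rule eventually_nhds_in_open) (use a False in auto)
    then have "\<forall>\<^sub>F z in nhds a. g z \<noteq> 0" by eventually_elim simp
    then have 1: "\<forall>\<^sub>F z in nhds a. f z / g z = h z" by eventually_elim (simp add: h_def)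
    have "((\<lambda>z. f z / g z) has_field_derivative
        (deriv f a * g a - f a * deriv g a) / (g a * g a)) (at a)"
      by (intro DERIV_divide holomorphic_derivI[OF f S a] holomorphic_derivI[OF g S a] False)
    then have "(h has_field_derivative (deriv f a * g a - f a * deriv g a) / (g a * g a)) (at a)"
      using DERIV_cong_ev[OF refl 1 refl] by (rule iffD1[rotated])
    then show ?thesis ..
  next
    case True
    then have fa: "f a = 0" and g': "deriv g a \<noteq> 0" using zero a by auto
    have df: "((\<lambda>z. (f z - f a) / (z - a)) \<longlongrightarrow> deriv f a) (at a)"
      and dg: "((\<lambda>z. (g z - g a) / (z - a)) \<longlongrightarrow> deriv g a) (at a)"
      using holomorphic_derivI[OF f S a] holomorphic_derivI[OF g S a]
      by (simp_all add: has_field_derivative_iff)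
    have "\<forall>\<^sub>F z in at a. (g z - g a) / (z - a) \<noteq> 0"
      using tendsto_imp_eventually_ne[OF dg g'] .
    then have gnz: "\<forall>\<^sub>F z in at a. g z \<noteq> 0" using True by (auto elim: eventually_mono)
    moreover have "\<forall>\<^sub>F z in at a. z \<in> S \<and> z \<noteq> a"
      unfolding eventually_at_filter using eventually_nhds_in_open[OF S a] by eventually_elim simp
    ultimately have ev: "\<forall>\<^sub>F z in at a. ((f z - f a) / (z - a)) / ((g z - g a) / (z - a)) = h z"
      by eventually_elim (use True fa in \<open>simp add: h_def\<close>)
    have "((\<lambda>z. ((f z - f a) / (z - a)) / ((g z - g a) / (z - a))) \<longlongrightarrow> deriv f a / deriv g a) (at a)"
      by (intro tendsto_divide df dg g')
    then have "(h \<longlongrightarrow> deriv f a / deriv g a) (at a)"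
      using ev by (rule Lim_transform_eventually)
    moreover have "h a = deriv f a / deriv g a" using True by (simp add: h_def)
    ultimately have lim: "(h \<longlongrightarrow> h a) (at a)" by (simp only:)
    obtain r where r: "r > 0" "ball a r \<subseteq> S" "\<And>z. z \<in> ball a r \<Longrightarrow> z \<noteq> a \<Longrightarrow> g z \<noteq> 0"
    proof -
      obtain r1 where "r1 > 0" "ball a r1 \<subseteq> S" using S a open_contains_ball by blast
      moreover obtain r2 where "r2 > 0" "\<And>z. z \<noteq> a \<Longrightarrow> dist z a < r2 \<Longrightarrow> g z \<noteq> 0"
        using gnz unfolding eventually_at by auto
      ultimately show ?thesis by (intro that[of "min r1 r2"]) (auto simp: dist_commute)
    qed
    have "h holomorphic_on ball a r"
    proof (rule no_isolated_singularity')
      show "(h \<longlongrightarrow> h z) (at z within ball a r)" if "z \<in> {a}" for z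
        using lim that by (auto intro: tendsto_within_subset)
      have "(\<lambda>z. f z / g z) holomorphic_on ball a r - {a}"
        by (intro holomorphic_intros holomorphic_on_subset[OF f] holomorphic_on_subset[OF g]) (use r in auto)
      then show "h holomorphic_on ball a r - {a}"
        by (rule holomorphic_transform) (use r in \<open>auto simp: h_def\<close>)
    qed auto
    then show ?thesis using r(1) by (meson centre_in_ball holomorphic_derivI open_ball)
  qed
  then have "h holomorphic_on S" by (simp add: holomorphic_on_open[OF S])
  moreover have "f z = g z * h z" if "z \<in> S" for z
    using zero that by (cases "g z = 0") (auto simp: h_def)
  ultimately show ?thesis using that by blast
qed

text \<open>The common multiplier makes f / g invariant under x -> p x, and simple zeros of g
  cancelled by f leave no poles. An invariant holomorphic function is determined on a compact
  annulus, hence bounded, hence constant.\<close>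

lemma quasi_periodic_unique:
  assumes p: "p \<noteq> 0" "norm p < 1"
    and f: "f holomorphic_on - {0}" and g: "g holomorphic_on - {0}"
    and m: "\<And>x. x \<noteq> 0 \<Longrightarrow> m x \<noteq> 0"
    and fp: "\<And>x. x \<noteq> 0 \<Longrightarrow> f (p * x) = m x * f x"
    and gp: "\<And>x. x \<noteq> 0 \<Longrightarrow> g (p * x) = m x * g x"
    and zero: "\<And>x. x \<noteq> 0 \<Longrightarrow> g x = 0 \<Longrightarrow> f x = 0 \<and> deriv g x \<noteq> 0"
    and x1: "x1 \<noteq> 0" "g x1 \<noteq> 0"
  obtains c where "\<And>x. x \<noteq> 0 \<Longrightarrow> f x = c * g x"
proof -
  obtain h where h: "h holomorphic_on - {0}" and fgh: "\<And>x. x \<in> - {0} \<Longrightarrow> f x = g x * h x"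
    by (rule holomorphic_quotient_simple_zeros[OF _ f g]) (use zero in auto)
  have hp0: "h (p * x) = h x" if "x \<noteq> 0" "g x \<noteq> 0" for x
  proof -
    have "g (p * x) * h (p * x) = m x * (g x * h x)" using fgh[of x] fgh[of "p * x"] fp[of x] p that by simp
    then show ?thesis using gp[OF that(1)] m[OF that(1)] that(2) by simp
  qed
  define U where "U = {x \<in> - {0}. g x \<noteq> 0}"
  have oU: "open U"
  proof -
    have "U = (- {0}) \<inter> g -` (- {0})" by (auto simp: U_def)
    then show ?thesis
      using continuous_open_preimage[OF holomorphic_on_imp_continuous_on[OF g], of "- {0}"] by auto
  qed
  \<comment> \<open>The multiplier can be cancelled only where \<open>g\<close> does not vanish; the
    identity theorem extends the invariance from the open set \<open>U\<close>.\<close>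
  have hp: "h (p * x) = h x" if "x \<noteq> 0" for x
  proof (rule analytic_continuation_open[where s = U and s' = "- {0}" and f = "\<lambda>x. h (p * x)" and g = h])
    show "(\<lambda>x. h (p * x)) holomorphic_on - {0}"
      using holomorphic_on_compose_gen[OF _ h, of "(*) p" "- {0}"] p
      by (auto simp: o_def image_iff intro!: holomorphic_intros)
    show "connected (- {0 :: complex})" by (simp add: connected_punctured_universe)
    show "U \<noteq> {}" using x1 by (auto simp: U_def)
  qed (use that h hp0 oU in \<open>auto simp: U_def\<close>)
  have hpn: "h (p powi k * x) = h x" if "x \<noteq> 0" for x k
  proof (induction k rule: int_induct[where k = 0])
    case (step1 i)
    then show ?case using hp[of "p powi i * x"] that p by (simp add: power_int_add mult_ac)
  next
    case (step2 i)
    have "p * (p powi (i - 1) * x) = p powi i * x" using p by (simp add: power_int_diff)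
    moreover have "h (p * (p powi (i - 1) * x)) = h (p powi (i - 1) * x)"
      using that p by (intro hp) simp
    ultimately show ?case using step2 by (simp only:)
  qed simp
  define A where "A = cball 0 1 - ball (0 :: complex) (norm p)"
  have "A \<subseteq> - {0}" using p by (auto simp: A_def)
  moreover have "compact A" unfolding A_def by (intro compact_diff) auto
  ultimately have "bounded (h ` A)"
    using h by (meson compact_continuous_image compact_imp_bounded continuous_on_subset holomorphic_on_imp_continuous_on)
  then obtain B where B: "\<And>x. x \<in> A \<Longrightarrow> norm (h x) \<le> B" unfolding bounded_iff by auto
  have Bx: "norm (h x) \<le> B" if "x \<noteq> 0" for x
  proof -
    \<comment> \<open>As ln (norm p) < 0, this \<open>k\<close> satisfies |p|^(k+1) < |x| \<le>
      |p|^k, so the factor \<open>p powi (- k)\<close> moves \<open>x\<close> into the annulus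
      \<open>A\<close>.\<close>
    define k where "k = \<lfloor>ln (norm x) / ln (norm p)\<rfloor>"
    have lp: "ln (norm p) < 0" using p by simp
    have k: "of_int k \<le> ln (norm x) / ln (norm p)" "ln (norm x) / ln (norm p) < of_int k + 1"
      unfolding k_def by linarith+
    have "norm p powi k = exp (of_int k * ln (norm p))"
      using p by (simp add: powr_def flip: powr_real_of_int')
    then have "norm (p powi (- k) * x) = exp (ln (norm x) - of_int k * ln (norm p))"
      using that by (simp add: norm_mult norm_power_int norm_divide exp_diff power_int_minus norm_inverse field_simps)
    moreover have "ln (norm x) - of_int k * ln (norm p) \<le> 0" "ln (norm p) \<le> ln (norm x) - of_int k * ln (norm p)"
      using k lp by (auto simp: field_simps)
    ultimately have "norm (p powi (- k) * x) \<le> 1" "norm p \<le> norm (p powi (- k) * x)"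
      using p by (simp, metis exp_le_cancel_iff exp_ln zero_less_norm_iff)
    then have "p powi (- k) * x \<in> A" by (auto simp: A_def)
    then show ?thesis using B hpn[OF that, of "- k"] by metis
  qed
  \<comment> \<open>Composition with exp, which maps the plane onto the punctured plane, yields a
    bounded entire function.\<close>
  have "(\<lambda>u. h (exp u)) holomorphic_on UNIV"
    using holomorphic_on_compose_gen[OF holomorphic_on_exp h, of UNIV] by (auto simp: o_def image_iff)
  moreover have "bounded (range (\<lambda>u. h (exp u)))"
    using Bx by (auto simp: bounded_iff intro!: exI[of _ B])
  ultimately obtain c where c: "\<And>u. h (exp u) = c"
    using Liouville_theorem unfolding constant_on_def by blast
  have "h x = c" if "x \<noteq> 0" for x using c[of "Ln x"] that by simp
  then show ?thesis using fgh by (intro that[of c]) auto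
qed

subsection \<open>The q-Gauss sum\<close>

lemma continuous_on_qinf:
  assumes "norm p < 1"
  shows "continuous_on A (\<lambda>a. qinf a p)"
proof -
  have "(\<lambda>a. qinf a p) holomorphic_on {a. (a, p) \<in> UNIV \<times> ball 0 1}"
    using hol2_qinf unfolding hol2_def by blast
  then have "continuous_on UNIV (\<lambda>a. qinf a p)"
    using assms by (simp add: holomorphic_on_imp_continuous_on)
  then show ?thesis by (rule continuous_on_subset) simp
qed

lemma norm_qinf_le_exp:
  assumes "norm p < 1" "norm a \<le> R"
  shows "norm (qinf a p) \<le> exp (R / (1 - norm p))"
  by (rule order.trans[OF norm_qinf_le[OF assms(1)]]) (use assms in \<open>simp add: divide_right_mono\<close>)

lemma norm_power_le_1: "norm (p :: complex) < 1 \<Longrightarrow> norm (p ^ n) \<le> 1"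
  by (simp add: norm_power power_le_one)

text \<open>The sum is written with cleared denominators and without dividing by \<open>a * b\<close>:
  for \<open>c = a * b * z\<close> it is \<open>(c, p; p)\<^sub>\<infinity>\<close> times the basic hypergeometric series with
  upper parameters \<open>a\<close>, \<open>b\<close>, lower parameter \<open>c\<close> and argument \<open>z = c / (a * b)\<close>.\<close>

lemma q_Gauss_sum:
  fixes a b z p :: complex
  assumes p: "norm p < 1" and z: "norm z < 1"
  shows "(\<Sum>n. qfin a p n * qfin b p n * z ^ n * (qinf (a * b * z * p ^ n) p * qinf (p * p ^ n) p)) * qinf z p
    = qinf p p * (qinf (a * z) p * qinf (b * z) p)"
proof -
  define T where "T z n = qfin a p n * qfin b p n * z ^ n * (qinf (a * b * z * p ^ n) p * qinf (p * p ^ n) p)"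
    for z n
  define f where "f z = (\<Sum>n. T z n)" for z
  \<comment> \<open>Product of the bounds for the four q-products, uniform for |w| \<le> |z|; since
    |z| < 1, the parameter a b w stays below |a| |b|.\<close>
  define K where "K = exp (norm a / (1 - norm p)) * exp (norm b / (1 - norm p)) *
    (exp (norm a * norm b / (1 - norm p)) * exp (1 / (1 - norm p)))"
  have Tb: "norm (T w n) \<le> K * norm z ^ n" if "norm w \<le> norm z" for w n
  proof -
    have "norm (a * b * w) * norm (p ^ n) \<le> norm (a * b * w) * 1"
      by (intro mult_left_mono norm_power_le_1 p) auto
    also have "\<dots> \<le> norm (a * b) * 1"
      using that z by (simp only: norm_mult mult_1_right) (intro mult_left_le; simp)
    finally have 1: "norm (a * b * w * p ^ n) \<le> norm a * norm b" by (simp only: norm_mult mult_1_right)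
    have 2: "norm (p * p ^ n) \<le> 1" using norm_power_le_1[OF p, of "Suc n"] by simp
    have "norm (T w n) \<le> exp (norm a / (1 - norm p)) * exp (norm b / (1 - norm p)) * norm z ^ n *
        (exp (norm a * norm b / (1 - norm p)) * exp (1 / (1 - norm p)))"
      unfolding T_def norm_mult norm_power[of w]
      by (intro mult_mono norm_qfin_le[OF p] norm_qinf_le_exp[OF p] power_mono 1 2 that
          mult_nonneg_nonneg norm_ge_zero zero_le_power exp_ge_zero)
    then show ?thesis by (simp add: K_def mult_ac)
  qed
  have sK: "summable (\<lambda>n. K * norm z ^ n)" using z by (intro summable_mult summable_geometric) simp
  have Ts: "summable (T w)" if "norm w \<le> norm z" for w
    by (rule summable_comparison_test'[OF sK, of 0]) (use Tb that in auto)
  \<comment> \<open>Contiguous relation in the argument. Its iteration along w, p w, p^2 w, ...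
    builds the three infinite products and leaves only the value of \<open>f\<close> at 0.\<close>
  have step: "(1 - w) * f w = (1 - a * w) * (1 - b * w) * f (p * w)" if w: "norm w \<le> norm z" for w
  proof -
    have pw: "norm (p * w) \<le> norm z"
    proof -
      have "norm p * norm w \<le> 1 * norm w" using p by (intro mult_right_mono) auto
      then show ?thesis using w by (simp add: norm_mult)
    qed
    \<comment> \<open>antidifference found from the ansatz (rational function of the power) times summand\<close>
    define S where "S n = - ((1 - p ^ n) * T w n)" for n
    have "S (Suc n) - S n = (1 - w) * T w n - (1 - a * w) * (1 - b * w) * T (p * w) n" for n
    proof -
      have X: "qinf (a * b * w * p ^ n) p = (1 - a * b * w * p ^ n) * qinf (a * b * w * p ^ n * p) p"
        and Y: "qinf (p * p ^ n) p = (1 - p * p ^ n) * qinf (p * p ^ n * p) p"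
        using p by (rule qinf_rec)+
      have e: "a * b * w * p ^ Suc n = a * b * w * p ^ n * p" "p * p ^ Suc n = p * p ^ n * p"
        "a * b * (p * w) * p ^ n = a * b * w * p ^ n * p" by (simp_all add: mult_ac)
      show ?thesis
        unfolding S_def T_def e unfolding X Y
        unfolding qfin_Suc power_mult_distrib power_Suc by algebra
    qed
    moreover have "S \<longlonglongrightarrow> - ((1 - 0) * 0) - 0 * 0"
    proof -
      have "T w \<longlonglongrightarrow> 0" by (rule summable_LIMSEQ_zero[OF Ts[OF w]])
      moreover have "(\<lambda>n. p ^ n * T w n) \<longlonglongrightarrow> 0"
      proof (rule Lim_null_comparison[OF _ tendsto_norm_zero[OF \<open>T w \<longlonglongrightarrow> 0\<close>]])
        show "\<forall>\<^sub>F n in sequentially. norm (p ^ n * T w n) \<le> norm (T w n)"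
          using norm_power_le_1[OF p] by (simp add: norm_mult mult_left_le_one_le)
      qed
      ultimately have "(\<lambda>n. - (T w n - p ^ n * T w n)) \<longlonglongrightarrow> - (0 - 0)" by (intro tendsto_intros)
      then show ?thesis unfolding S_def by (simp add: algebra_simps)
    qed
    ultimately have "(\<lambda>n. (1 - w) * T w n - (1 - a * w) * (1 - b * w) * T (p * w) n) sums 0"
      using telescope_sums[of S 0] by (simp add: S_def)
    moreover have "(\<lambda>n. (1 - w) * T w n - (1 - a * w) * (1 - b * w) * T (p * w) n) sums
        ((1 - w) * f w - (1 - a * w) * (1 - b * w) * f (p * w))"
      unfolding f_def by (intro sums_diff sums_mult summable_sums Ts w pw)
    ultimately show ?thesis using sums_unique2 by fastforce
  qed
  have pz: "norm (p ^ m * z) \<le> norm z" for m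
    using norm_power_le_1[OF p, of m] by (simp add: norm_mult mult_left_le_one_le)
  have iter: "f z * qfin z p m = qfin (a * z) p m * qfin (b * z) p m * f (p ^ m * z)" for m
  proof (induction m)
    case (Suc m)
    have "f z * qfin z p (Suc m) = qfin (a * z) p m * qfin (b * z) p m * ((1 - p ^ m * z) * f (p ^ m * z))"
      using Suc by (simp add: qfin_Suc mult_ac)
    also have "\<dots> = qfin (a * z) p (Suc m) * qfin (b * z) p (Suc m) * f (p ^ Suc m * z)"
      unfolding step[OF pz] by (simp add: qfin_Suc mult_ac)
    finally show ?case .
  qed simp
  \<comment> \<open>Continuity up to 0 is what allows the passage to the limit in
    \<open>iter\<close>.\<close>
  have "continuous_on (cball 0 (norm z)) f"
  proof (rule uniform_limit_theorem)
    show "uniform_limit (cball 0 (norm z)) (\<lambda>n w. \<Sum>i<n. T w i) f sequentially"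
      unfolding f_def by (rule Weierstrass_m_test[OF Tb sK]) auto
    show "\<forall>\<^sub>F n in sequentially. continuous_on (cball 0 (norm z)) (\<lambda>w. \<Sum>i<n. T w i)"
      unfolding T_def
      by (intro always_eventually allI continuous_intros continuous_on_compose2[OF continuous_on_qinf[OF p]]) auto
  qed simp
  moreover have "(\<lambda>m. p ^ m * z) \<longlonglongrightarrow> 0"
    using p by (intro tendsto_mult_left_zero LIMSEQ_power_zero)
  ultimately have "(\<lambda>m. f (p ^ m * z)) \<longlonglongrightarrow> f 0"
    by (rule continuous_on_tendsto_compose) (use pz in \<open>auto intro!: always_eventually\<close>)
  then have "(\<lambda>m. qfin (a * z) p m * qfin (b * z) p m * f (p ^ m * z)) \<longlonglongrightarrow> qinf (a * z) p * qinf (b * z) p * f 0"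
    by (intro tendsto_intros qfin_tendsto p)
  moreover have "(\<lambda>m. f z * qfin z p m) \<longlonglongrightarrow> f z * qinf z p"
    by (intro tendsto_intros qfin_tendsto p)
  ultimately have "f z * qinf z p = qinf (a * z) p * qinf (b * z) p * f 0"
    unfolding iter by (rule LIMSEQ_unique[rotated])
  moreover have "f 0 = qinf p p"
  proof -
    \<comment> \<open>At argument 0 only n = 0 survives, with 0^0 = 1, and the lower parameter a b w
      is 0 as well.\<close>
    have "f 0 = (\<Sum>n\<in>{0}. T 0 n)"
      unfolding f_def by (rule suminf_finite) (auto simp: T_def power_0_left)
    also have "\<dots> = qinf p p" by (simp add: T_def qinf_eq)
    finally show ?thesis .
  qed
  ultimately have "f z * qinf z p = qinf (a * z) p * qinf (b * z) p * qinf p p" by (simp only:)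
  then show ?thesis unfolding f_def T_def by (simp only: mult.commute[of "qinf p p"])
qed

subsection \<open>The rank generating function\<close>

text \<open>\<open>M_fun\<close> is \<open>N_fun\<close> times \<open>(x q\<^sup>2, q\<^sup>2 / x; q\<^sup>2)\<^sub>\<infinity>\<close>, which removes all poles in \<open>x \<noteq> 0\<close>.\<close>

definition M_term :: "nat \<Rightarrow> complex \<Rightarrow> complex \<Rightarrow> complex" where
  "M_term n x q = qfin (-1) (q^2) n * qfin (-q) (q^2) n * q ^ n *
     (qinf (x * (q^2) ^ Suc n) (q^2) * qinf ((q^2) ^ Suc n / x) (q^2))"

definition M_fun :: "complex \<Rightarrow> complex \<Rightarrow> complex" where
  "M_fun x q = (\<Sum>n. M_term n x q)"

lemma norm_square_less_1: "norm (q :: complex) < 1 \<Longrightarrow> norm (q^2) < 1"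
  by (simp add: norm_power power_less_one_iff)

text \<open>Both x and 1 / x occur in the terms, so \<open>R\<close> bounds both; the result is a
  geometric majorant that is locally uniform in x \<noteq> 0 and |q| < 1.\<close>

lemma norm_M_term_le:
  assumes q: "norm q \<le> r" "r < 1" and x: "norm x \<le> R" "norm (1 / x) \<le> R"
  shows "norm (M_term n x q) \<le> exp (1 / (1 - r)) ^ 2 * exp (R / (1 - r)) ^ 2 * r ^ n"
proof -
  have q1: "norm q < 1" and r0: "0 \<le> r" using q norm_ge_zero[of q] by linarith+
  note q2 = norm_square_less_1[OF q1]
  have "norm (q^2) \<le> norm q" using q1 by (simp add: power2_eq_square norm_mult mult_left_le)
  then have qr: "norm (q^2) \<le> r" using q by simp
  have R0: "0 \<le> R" using x(1) norm_ge_zero[of x] by linarith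
  have e: "exp (s / (1 - norm (q^2))) \<le> exp (s' / (1 - r))" if "s \<le> s'" "0 \<le> s'" for s s'
    using that qr q(2) q2 by (simp add: frac_le)
  have A: "norm (qfin a (q^2) n) \<le> exp (1 / (1 - r))" if "norm a \<le> 1" for a
    by (rule order.trans[OF norm_qfin_le[OF q2] e[OF that]]) simp
  have B: "norm (qinf a (q^2)) \<le> exp (R / (1 - r))" if "norm a \<le> R" for a
    by (rule order.trans[OF norm_qinf_le[OF q2] e[OF that R0]])
  have p: "norm ((q^2) ^ Suc n) \<le> 1" by (rule norm_power_le_1[OF q2])
  have 1: "norm (x * (q^2) ^ Suc n) \<le> R"
    using mult_mono[OF x(1) p R0 norm_ge_zero] by (simp only: norm_mult mult_1_right)
  have 2: "norm ((q^2) ^ Suc n / x) \<le> R"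
    using mult_mono[OF x(2) p R0 norm_ge_zero] unfolding norm_mult[symmetric] by simp
  have "norm (M_term n x q) \<le> exp (1 / (1 - r)) * exp (1 / (1 - r)) * r ^ n * (exp (R / (1 - r)) * exp (R / (1 - r)))"
    unfolding M_term_def norm_mult norm_power[of q n]
    by (intro mult_mono A B 1 2 power_mono q(1) mult_nonneg_nonneg norm_ge_zero zero_le_power exp_ge_zero r0)
       (use q1 in auto)
  then show ?thesis by (simp add: power2_eq_square mult_ac)
qed

lemma summable_M_term:
  assumes "norm q < 1"
  shows "summable (\<lambda>n. M_term n x q)"
proof (rule summable_comparison_test')
  let ?R = "max (norm x) (norm (1 / x))"
  show "summable (\<lambda>n. exp (1 / (1 - norm q)) ^ 2 * exp (?R / (1 - norm q)) ^ 2 * norm q ^ n)"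
    using assms by (intro summable_mult summable_geometric) simp
  show "norm (M_term n x q) \<le> exp (1 / (1 - norm q)) ^ 2 * exp (?R / (1 - norm q)) ^ 2 * norm q ^ n" for n
    by (rule norm_M_term_le) (use assms in auto)
qed

abbreviation DOM :: "(complex \<times> complex) set" where
  "DOM \<equiv> (- {0}) \<times> ball 0 1"

lemma open_DOM: "open DOM"
  by (intro open_Times) auto

lemma hol2_M_fun: "hol2 M_fun DOM"
proof (rule hol2_uniform_limit[OF open_DOM, where f = "\<lambda>n x q. \<Sum>i<n. M_term i x q"])
  show "hol2 (\<lambda>x q. \<Sum>i<n. M_term i x q) DOM" for n
    unfolding M_term_def qfin_def
    by (intro hol2_sum hol2_prod hol2_mult hol2_diff hol2_power hol2_const hol2_qinf_compose hol2_divide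
        hol2_minus hol2_fst hol2_snd open_DOM)
       (auto simp: norm_power power_less_one_iff)
  fix z assume z: "z \<in> DOM"
  then have z': "z \<in> UNIV \<times> ball 0 1" by auto
  obtain d1 R1 r where d1: "d1 > 0" "0 \<le> r" "r < 1"
    "\<And>x y. (x, y) \<in> cball z d1 \<Longrightarrow> norm x \<le> R1 \<and> norm y \<le> r"
    using cball_UNIV_disc[OF z'] by metis
  obtain d2 where d2: "d2 > 0" "cball z d2 \<subseteq> DOM" using open_DOM z open_contains_cball by blast
  define d where "d = min d1 d2"
  have d: "d > 0" "cball z d \<subseteq> DOM" "cball z d \<subseteq> cball z d1" using d1 d2 by (auto simp: d_def)
  have "continuous_on (cball z d) (\<lambda>w. 1 / fst w)"
    using d(2) by (intro continuous_intros) auto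
  then have "bounded ((\<lambda>w. 1 / fst w) ` cball z d)"
    by (intro compact_imp_bounded compact_continuous_image) auto
  then obtain R2 where R2: "\<And>w. w \<in> cball z d \<Longrightarrow> norm (1 / fst w) \<le> R2" unfolding bounded_iff by blast
  define R where "R = max R1 R2"
  have "uniform_limit (cball z d) (\<lambda>n w. \<Sum>i<n. M_term i (fst w) (snd w))
      (\<lambda>w. \<Sum>i. M_term i (fst w) (snd w)) sequentially"
  proof (rule Weierstrass_m_test)
    fix n w assume w: "w \<in> cball z d"
    then have "(fst w, snd w) \<in> cball z d1" using d(3) by auto
    from d1(4)[OF this] R2[OF w]
    show "norm (M_term n (fst w) (snd w)) \<le> exp (1 / (1 - r)) ^ 2 * exp (R / (1 - r)) ^ 2 * r ^ n"
      using d1 by (intro norm_M_term_le) (auto simp: R_def)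
  qed (use d1 in \<open>auto intro!: summable_mult summable_geometric\<close>)
  then show "\<exists>d>0. cball z d \<subseteq> DOM \<and>
      uniform_limit (cball z d) (\<lambda>n (x, y). \<Sum>i<n. M_term i x y) (\<lambda>(x, y). M_fun x y) sequentially"
    using d unfolding M_fun_def case_prod_unfold by blast
qed

lemma M_fun_inverse: "M_fun (1 / x) q = M_fun x q"
  unfolding M_fun_def M_term_def by (simp add: mult_ac)

text \<open>Euler's identity behind partitions into odd and into distinct parts: factor (q^2; q^2)
  and (q; q) in two ways and cancel the nonzero (q^2; q^2).\<close>

lemma qinf_Euler:
  assumes q: "norm q < 1"
  shows "qinf q (q^2) * qinf (-q) q = 1"
proof -
  have "qinf (q^2) (q^2) = qinf q q * qinf (-q) q" using qinf_square[OF q, of q] by simp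
  also have "qinf q q = qinf q (q^2) * qinf (q^2) (q^2)"
    using qinf_square_base[OF q, of q] by (simp add: power2_eq_square)
  finally show ?thesis using qinf_self_neq_0[OF norm_square_less_1[OF q]] by simp
qed

text \<open>The q-Gauss sum in base q^2 with a = -1, b = -q, z = q: then a b z = q^2 equals the
  base, so both lower products agree with those of the series at x = 1. Euler's identity removes the
  remaining factor (q; q^2).\<close>

lemma M_fun_1:
  assumes q: "norm q < 1"
  shows "M_fun 1 q = qinf (q^2) (q^2) * (qinf (-q) q)^2"
proof -
  let ?p = "q^2"
  note p = norm_square_less_1[OF q]
  have "M_fun 1 q = (\<Sum>n. qfin (-1) ?p n * qfin (-q) ?p n * q ^ n *
      (qinf (- 1 * - q * q * ?p ^ n) ?p * qinf (?p * ?p ^ n) ?p))"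
    unfolding M_fun_def M_term_def by (simp add: power2_eq_square)
  then have 1: "M_fun 1 q * qinf q ?p = qinf ?p ?p * qinf (-q) q"
    using q_Gauss_sum[OF p q, of "-1" "-q"] qinf_square_base[OF q, of "-q"]
    by (simp add: power2_eq_square mult_ac)
  have "M_fun 1 q = M_fun 1 q * (qinf q ?p * qinf (-q) q)" using qinf_Euler[OF q] by simp
  also have "\<dots> = qinf ?p ?p * (qinf (-q) q)^2" using 1 by (simp add: power2_eq_square mult_ac)
  finally show ?thesis .
qed

text \<open>The terms at q^2 x and at x differ by a telescoping difference. The theta term is its
  boundary value at n = 0; the other end tends to 0 with the terms of a convergent series.\<close>

lemma M_fun_shift:
  assumes q: "norm q < 1" "q \<noteq> 0" and x: "x \<noteq> 0"
  shows "(1 + q^2 * x) * M_fun (q^2 * x) q = q * ((1 + x) * M_fun x q) - (1 - q * x) * J_fun x (q^2) / x"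
proof -
  let ?p = "q^2"
  note p = norm_square_less_1[OF q(1)]
  \<comment> \<open>antidifference found from the ansatz (rational function of the power) times summand\<close>
  define S where "S n = - (1 - q * x) * (1 - ?p ^ n / x) * M_term n x q" for n
  have "S (Suc n) - S n = (1 + ?p * x) * M_term n (?p * x) q - q * (1 + x) * M_term n x q" for n
  proof -
    \<comment> \<open>With u = y / x as a variable and y = u x, all quotients disappear and the
      telescoping relation becomes a polynomial identity.\<close>
    define y u A X Y where "y = ?p ^ n" and "u = y / x" and "A = qfin (-1) ?p n * qfin (-q) ?p n * q ^ n"
      and "X = qinf (x * (?p * (?p * y))) ?p" and "Y = qinf (?p * (?p * u)) ?p"
    note defs = this
    have y: "y = u * x" and pu: "?p * y / x = ?p * u" using x by (simp_all add: defs)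
    have "qinf (x * (?p * y)) ?p = (1 - x * (?p * y)) * X"
      using qinf_rec[OF p, of "x * (?p * y)"] by (simp add: X_def mult_ac)
    moreover have Y: "qinf (?p * u) ?p = (1 - ?p * u) * Y"
      using qinf_rec[OF p, of "?p * u"] by (simp add: Y_def mult_ac)
    ultimately have 1: "M_term n x q = A * ((1 - x * (?p * y)) * X * ((1 - ?p * u) * Y))"
      unfolding M_term_def power_Suc y_def[symmetric] pu by (simp only: A_def)
    have "?p * (?p * y) / x = ?p * (?p * u)" by (simp add: u_def)
    then have 2: "M_term (Suc n) x q = A * (1 + y) * (1 + q * y) * q * (X * Y)"
      unfolding M_term_def qfin_Suc power_Suc y_def[symmetric] X_def Y_def by (simp add: A_def)
    have "qinf (?p * y / (?p * x)) ?p = (1 - u) * qinf (?p * u) ?p"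
      using qinf_rec[OF p, of u] q by (simp add: u_def mult_ac)
    moreover have "?p * x * (?p * y) = x * (?p * (?p * y))" by (simp add: mult_ac)
    ultimately have 3: "M_term n (?p * x) q = A * (X * ((1 - u) * ((1 - ?p * u) * Y)))"
      unfolding M_term_def power_Suc y_def[symmetric] X_def A_def by (simp only: Y)
    have 4: "?p ^ n / x = u" "?p ^ Suc n / x = ?p * u" by (simp_all add: defs)
    show ?thesis unfolding S_def 1 2 3 4 y by algebra
  qed
  moreover have "S \<longlonglongrightarrow> - (1 - q * x) * (1 - 0 / x) * 0"
    unfolding S_def using p x
    by (intro tendsto_intros summable_LIMSEQ_zero[OF summable_M_term[OF q(1)]] LIMSEQ_power_zero) auto
  ultimately have "(\<lambda>n. (1 + ?p * x) * M_term n (?p * x) q - q * (1 + x) * M_term n x q) sums (0 - S 0)"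
    using telescope_sums[of S 0] by simp
  moreover have "(\<lambda>n. (1 + ?p * x) * M_term n (?p * x) q - q * (1 + x) * M_term n x q) sums
      ((1 + ?p * x) * M_fun (?p * x) q - q * (1 + x) * M_fun x q)"
    unfolding M_fun_def by (intro sums_diff sums_mult summable_sums summable_M_term q)
  ultimately have "(1 + ?p * x) * M_fun (?p * x) q - q * (1 + x) * M_fun x q = - S 0"
    using sums_unique2 by fastforce
  also have "- S 0 = - ((1 - q * x) * J_fun x ?p / x)"
    using x by (simp add: S_def M_term_def J_fun_rec[OF p] field_simps)
  finally show ?thesis by (simp add: algebra_simps)
qed

text \<open>The tail products in \<open>M_term\<close> are the full products divided by the
  denominators of the series. Because \<open>qpoch\<close> is a quotient of infinite products, the
  tails belonging to -1 and -q must be shown nonzero before the numerators reduce to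
  \<open>qfin\<close>.\<close>

lemma N_fun_eq:
  assumes q: "norm q < 1"
    and nz: "qinf (x * q^2) (q^2) \<noteq> 0" "qinf (q^2 / x) (q^2) \<noteq> 0"
  shows "N_fun x q = M_fun x q / (qinf (x * q^2) (q^2) * qinf (q^2 / x) (q^2))"
proof -
  let ?p = "q^2" and ?D = "qinf (x * q^2) (q^2) * qinf (q^2 / x) (q^2)"
  note p = norm_square_less_1[OF q]
  have "qpoch [-1, -q] ?p n * q ^ n / qpoch [x * ?p, ?p / x] ?p n = M_term n x q / ?D" for n
  proof -
    have "qinf (-1 * ?p ^ n) ?p \<noteq> 0"
    proof (unfold qinf_eq_0_iff[OF p], safe)
      fix t assume e: "-1 * ?p ^ n * ?p ^ t = 1"
      then have "norm (?p ^ (n + t)) = 1" by (metis mult_minus1 mult_minus_left norm_minus_cancel norm_one power_add)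
      \<comment> \<open>As |q^2| < 1, only the exponent 0 remains, where the assumed equation reads
        -1 = 1.\<close>
      then have "n + t = 0" using p by (metis norm_power power_less_one_iff norm_ge_zero not_gr_zero order_less_irrefl)
      with e show False by simp
    qed
    moreover have "qinf (-q * ?p ^ n) ?p \<noteq> 0"
    proof (unfold qinf_eq_0_iff[OF p], safe)
      fix t assume e: "-q * ?p ^ n * ?p ^ t = 1"
      have "norm (-q * ?p ^ n * ?p ^ t) = norm q * norm (?p ^ (n + t))" by (simp add: norm_mult power_add)
      also have "\<dots> \<le> norm q * 1" by (intro mult_left_mono norm_power_le_1 p) auto
      finally show False using q unfolding e by simp
    qed
    ultimately have "qpoch [-1, -q] ?p n = qfin (-1) ?p n * qfin (-q) ?p n"
      using qinf_split[OF p, of "-1" n] qinf_split[OF p, of "-q" n]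
      by (simp add: qpoch_def qpoch_inf_pair p)
    moreover have "qpoch [x * ?p, ?p / x] ?p n = ?D / (qinf (x * ?p ^ Suc n) ?p * qinf (?p ^ Suc n / x) ?p)"
      by (simp add: qpoch_def qpoch_inf_pair p mult_ac)
    ultimately show ?thesis by (simp add: M_term_def)
  qed
  then have "N_fun x q = (\<Sum>n. M_term n x q / ?D)" by (simp add: N_fun_def)
  also have "\<dots> = M_fun x q / ?D"
    unfolding M_fun_def by (rule suminf_divide[OF summable_M_term[OF q]])
  finally show ?thesis .
qed

lemma N_star_eq:
  assumes "norm q < 1" "J_fun x (q^2) \<noteq> 0"
  shows "N_star x q = M_fun x q / J_fun x (q^2)"
proof -
  note p = norm_square_less_1[OF assms(1)]
  have "N_fun x q = M_fun x q / (qinf (x * q^2) (q^2) * qinf (q^2 / x) (q^2))"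
    by (rule N_fun_eq) (use assms J_fun_rec[OF p, of x] in auto)
  then show ?thesis by (simp add: N_star_def J_fun_rec[OF p] mult_ac)
qed

subsection \<open>Functional equations\<close>

lemma hol2_delta_x: "hol2 f S \<Longrightarrow> hol2 (delta_x f) S"
  and hol2_delta_q: "hol2 f S \<Longrightarrow> hol2 (delta_q f) S"
  unfolding delta_x_def[abs_def] delta_q_def[abs_def]
  by (auto intro!: hol2_mult hol2_fst hol2_snd hol2_deriv_fst hol2_deriv_snd simp: hol2_def[of f])

lemma hol2_delta_x_D:
  assumes "hol2 f S" "(x, q) \<in> S" "x \<noteq> 0"
  shows "((\<lambda>x. f x q) has_field_derivative delta_x f x q / x) (at x)"
  using hol2_D(1)[OF assms(1,2)] assms(3) by (simp add: delta_x_def)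

lemma hol2_delta_q_D:
  assumes "hol2 f S" "(x, q) \<in> S" "q \<noteq> 0"
  shows "((\<lambda>q. f x q) has_field_derivative delta_q f x q / q) (at q)"
  using hol2_D(2)[OF assms(1,2)] assms(3) by (simp add: delta_q_def)

lemma delta_q_eqI:
  assumes "(f x has_field_derivative d) (at q)"
  shows "delta_q f x q = q * d"
  using DERIV_imp_deriv[OF assms] by (simp add: delta_q_def)

section \<open>Euler operators under dilation and inversion\<close>

lemma delta_x_shift:
  assumes f: "hol2 f DOM" and D: "x \<noteq> 0" "q \<noteq> 0" "norm q < 1"
    and fg: "\<And>x. x \<noteq> 0 \<Longrightarrow> f (q^2 * x) q = g x"
    and g: "(g has_field_derivative d) (at x)"
  shows "delta_x f (q^2 * x) q = x * d"
proof -
  have "((\<lambda>x. f (q^2 * x) q) has_field_derivative delta_x f (q^2 * x) q / (q^2 * x) * q^2) (at x)"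
    by (rule DERIV_chain2[OF hol2_delta_x_D[OF f]]) (use D in \<open>auto intro!: derivative_eq_intros\<close>)
  moreover have "\<forall>\<^sub>F y in nhds x. g y = f (q^2 * y) q"
    using D fg by (intro eventually_nhds_in_open[THEN eventually_mono, of "- {0}"]) auto
  from DERIV_cong_ev[OF refl this refl] g
  have "((\<lambda>x. f (q^2 * x) q) has_field_derivative d) (at x)" by (rule iffD1)
  ultimately have "delta_x f (q^2 * x) q / (q^2 * x) * q^2 = d" by (rule DERIV_unique)
  then show ?thesis using D by auto
qed

text \<open>The dilation factor q^2 itself depends on q, and its exponent contributes the additional
  2 \<open>delta_x\<close>. This term is what the second x-derivative of the heat operator
  compensates.\<close>

lemma delta_q_shift:
  assumes f: "hol2 f DOM" and D: "x \<noteq> 0" "q \<noteq> 0" "norm q < 1"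
    and fg: "\<And>q. q \<noteq> 0 \<Longrightarrow> norm q < 1 \<Longrightarrow> f (q^2 * x) q = g q"
    and g: "(g has_field_derivative d) (at q)"
  shows "delta_q f (q^2 * x) q + 2 * delta_x f (q^2 * x) q = q * d"
proof -
  have "((\<lambda>q. f (q^2 * x) q) has_field_derivative
      deriv (\<lambda>y. f y q) (q^2 * x) * (2 * q * x) + deriv (f (q^2 * x)) q * 1) (at q)"
    by (rule hol2_chain[OF f]) (use D in \<open>auto intro!: derivative_eq_intros\<close>)
  moreover have "\<forall>\<^sub>F r in nhds q. g r = f (r^2 * x) r"
    using D fg by (intro eventually_nhds_in_open[THEN eventually_mono, of "ball 0 1 - {0}"]) auto
  from DERIV_cong_ev[OF refl this refl] g
  have "((\<lambda>q. f (q^2 * x) q) has_field_derivative d) (at q)" by (rule iffD1)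
  ultimately have "deriv (\<lambda>y. f y q) (q^2 * x) * (2 * q * x) + deriv (f (q^2 * x)) q * 1 = d"
    by (rule DERIV_unique)
  then show ?thesis by (auto simp: delta_x_def delta_q_def algebra_simps power2_eq_square)
qed

text \<open>Inversion reverses the sign of \<open>delta_x\<close>, so the second power of this
  operator is invariant.\<close>

lemma delta_x_inverse:
  assumes f: "hol2 f DOM" and D: "x \<noteq> 0" "norm q < 1"
    and fg: "\<And>x. x \<noteq> 0 \<Longrightarrow> f (1 / x) q = g x"
    and g: "(g has_field_derivative d) (at x)"
  shows "delta_x f (1 / x) q = - (x * d)"
proof -
  have "((\<lambda>x. f (1 / x) q) has_field_derivative delta_x f (1 / x) q / (1 / x) * (- 1 / x^2)) (at x)"
    by (rule DERIV_chain2[OF hol2_delta_x_D[OF f]])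
       (use D in \<open>auto intro!: derivative_eq_intros simp: power2_eq_square\<close>)
  moreover have "\<forall>\<^sub>F y in nhds x. g y = f (1 / y) q"
    using D fg by (intro eventually_nhds_in_open[THEN eventually_mono, of "- {0}"]) auto
  from DERIV_cong_ev[OF refl this refl] g
  have "((\<lambda>x. f (1 / x) q) has_field_derivative d) (at x)" by (rule iffD1)
  ultimately have "delta_x f (1 / x) q / (1 / x) * (- 1 / x^2) = d" by (rule DERIV_unique)
  then show ?thesis using D by (auto simp: power2_eq_square)
qed

lemma delta_q_inverse:
  assumes f: "hol2 f DOM" and D: "x \<noteq> 0" "norm q < 1"
    and fg: "\<And>q. norm q < 1 \<Longrightarrow> f (1 / x) q = g q"
    and g: "(g has_field_derivative d) (at q)"
  shows "delta_q f (1 / x) q = q * d"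
proof -
  have "\<forall>\<^sub>F r in nhds q. g r = f (1 / x) r"
    using D fg by (intro eventually_nhds_in_open[THEN eventually_mono, of "ball 0 1"]) auto
  from DERIV_cong_ev[OF refl this refl] g
  have "(f (1 / x) has_field_derivative d) (at q)" by (rule iffD1)
  then show ?thesis by (rule delta_q_eqI)
qed

definition theta :: "complex \<Rightarrow> complex \<Rightarrow> complex" where
  "theta x q = J_fun x (q^2)"

definition E_fun :: "complex \<Rightarrow> complex \<Rightarrow> complex" where
  "E_fun x q = (1 + x) * M_fun x q"

lemma hol2_theta: "hol2 theta DOM"
  unfolding theta_def[abs_def]
  by (rule hol2_compose[OF hol2_J_fun hol2_fst hol2_power[OF hol2_snd]])
     (auto simp: open_DOM norm_power power_less_one_iff)

lemma hol2_E_fun: "hol2 E_fun DOM"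
  unfolding E_fun_def[abs_def]
  by (intro hol2_mult hol2_add hol2_const hol2_fst hol2_M_fun open_DOM)

text \<open>This is \<open>\<theta>\<^sup>3 (\<delta>\<^sub>q + \<delta>\<^sub>x\<^sup>2) (E / \<theta>)\<close> multiplied out, so that it makes sense at the zeros of \<open>\<theta>\<close>.\<close>

definition F_fun :: "complex \<Rightarrow> complex \<Rightarrow> complex" where
  "F_fun x q = theta x q ^ 2 * delta_q E_fun x q - theta x q * E_fun x q * delta_q theta x q
     + theta x q ^ 2 * delta_x (delta_x E_fun) x q - 2 * theta x q * delta_x E_fun x q * delta_x theta x q
     - theta x q * E_fun x q * delta_x (delta_x theta) x q + 2 * E_fun x q * delta_x theta x q ^ 2"

lemma hol2_F_fun: "hol2 F_fun DOM"
  unfolding F_fun_def[abs_def]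
  by (intro hol2_mult hol2_add hol2_diff hol2_power hol2_const hol2_delta_x hol2_delta_q hol2_theta
      hol2_E_fun open_DOM)

context
  fixes x q :: complex
  assumes D: "x \<noteq> 0" "q \<noteq> 0" "norm q < 1"
begin

lemma theta_E_deriv_x:
    "((\<lambda>x. theta x q) has_field_derivative delta_x theta x q / x) (at x)"
    "((\<lambda>x. delta_x theta x q) has_field_derivative delta_x (delta_x theta) x q / x) (at x)"
    "((\<lambda>x. E_fun x q) has_field_derivative delta_x E_fun x q / x) (at x)"
    "((\<lambda>x. delta_x E_fun x q) has_field_derivative delta_x (delta_x E_fun) x q / x) (at x)"
  by (rule hol2_delta_x_D[where S = DOM]; use D in \<open>simp add: hol2_theta hol2_E_fun hol2_delta_x\<close>)+

lemma theta_E_deriv_q: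
    "(theta x has_field_derivative delta_q theta x q / q) (at q)"
    "(E_fun x has_field_derivative delta_q E_fun x q / q) (at q)"
  by (rule hol2_delta_q_D[where S = DOM]; use D in \<open>simp add: hol2_theta hol2_E_fun\<close>)+

end

section \<open>Transformation laws of theta, of the numerator and of their derivatives\<close>

lemma theta_shift: "\<lbrakk>x \<noteq> 0; q \<noteq> 0; norm q < 1\<rbrakk> \<Longrightarrow> theta (q^2 * x) q = - theta x q / x"
  by (simp add: theta_def J_fun_shift norm_square_less_1)

lemma E_shift: "\<lbrakk>x \<noteq> 0; q \<noteq> 0; norm q < 1\<rbrakk> \<Longrightarrow>
    E_fun (q^2 * x) q = q * E_fun x q - (1 - q * x) * theta x q / x"
  by (simp add: theta_def E_fun_def M_fun_shift)

lemma theta_inverse: "\<lbrakk>x \<noteq> 0; norm q < 1\<rbrakk> \<Longrightarrow> theta (1 / x) q = - theta x q / x"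
  by (simp add: theta_def J_fun_inverse norm_square_less_1)

lemma E_inverse: "x \<noteq> 0 \<Longrightarrow> E_fun (1 / x) q = E_fun x q / x"
  unfolding E_fun_def M_fun_inverse by (simp add: field_simps)

context
  fixes x q :: complex
  assumes D: "x \<noteq> 0" "q \<noteq> 0" "norm q < 1"
begin

lemma theta_x_shift: "delta_x theta (q^2 * x) q = (theta x q - delta_x theta x q) / x"
proof -
  have d: "((\<lambda>x. - theta x q / x) has_field_derivative
      (- (delta_x theta x q / x) * x - - theta x q * 1) / (x * x)) (at x)"
    by (intro DERIV_divide DERIV_minus DERIV_ident theta_E_deriv_x D)
  show ?thesis
    by (rule trans[OF delta_x_shift[OF hol2_theta D theta_shift[OF _ D(2,3)] d]])
      (use D in \<open>simp_all add: field_simps\<close>)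
qed

lemma E_x_shift: "delta_x E_fun (q^2 * x) q =
    q * delta_x E_fun x q + theta x q / x - (1 - q * x) * delta_x theta x q / x"
proof -
  have d: "((\<lambda>x. q * E_fun x q - (1 - q * x) * theta x q / x) has_field_derivative
      q * (delta_x E_fun x q / x) -
      (((1 - q * x) * (delta_x theta x q / x) + - q * theta x q) * x - (1 - q * x) * theta x q * 1) / (x * x)) (at x)"
    using D by (auto intro!: derivative_eq_intros theta_E_deriv_x simp: field_simps)
  show ?thesis
    by (rule trans[OF delta_x_shift[OF hol2_E_fun D E_shift[OF _ D(2,3)] d]])
      (use D in \<open>simp_all add: field_simps\<close>)
qed

end

context
  fixes x q :: complex
  assumes D: "x \<noteq> 0" "q \<noteq> 0" "norm q < 1"
begin

text \<open>The first-order law is differentiated once more, so it is needed for all x near the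
  given point; the preceding context was closed to generalize it over x.\<close>

lemma theta_xx_shift: "delta_x (delta_x theta) (q^2 * x) q =
    (2 * delta_x theta x q - theta x q - delta_x (delta_x theta) x q) / x"
proof -
  have d: "((\<lambda>x. (theta x q - delta_x theta x q) / x) has_field_derivative
      ((delta_x theta x q / x - delta_x (delta_x theta) x q / x) * x - (theta x q - delta_x theta x q) * 1) / (x * x)) (at x)"
    by (intro DERIV_divide DERIV_diff DERIV_ident theta_E_deriv_x D)
  show ?thesis
    by (rule trans[OF delta_x_shift[OF hol2_delta_x[OF hol2_theta] D theta_x_shift[OF _ D(2,3)] d]])
      (use D in \<open>simp_all add: field_simps\<close>)
qed

lemma E_xx_shift: "delta_x (delta_x E_fun) (q^2 * x) q = q * delta_x (delta_x E_fun) x q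
    - theta x q / x + 2 * delta_x theta x q / x - (1 - q * x) * delta_x (delta_x theta) x q / x"
proof -
  have d: "((\<lambda>x. q * delta_x E_fun x q + theta x q / x - (1 - q * x) * delta_x theta x q / x) has_field_derivative
      q * (delta_x (delta_x E_fun) x q / x) + (delta_x theta x q / x * x - theta x q * 1) / (x * x) -
      (((1 - q * x) * (delta_x (delta_x theta) x q / x) + - q * delta_x theta x q) * x
        - (1 - q * x) * delta_x theta x q * 1) / (x * x)) (at x)"
    using D by (auto intro!: derivative_eq_intros theta_E_deriv_x simp: field_simps)
  show ?thesis
    by (rule trans[OF delta_x_shift[OF hol2_delta_x[OF hol2_E_fun] D E_x_shift[OF _ D(2,3)] d]])
      (use D in \<open>simp_all add: field_simps\<close>)
qed

lemma theta_q_shift: "delta_q theta (q^2 * x) q =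
    - delta_q theta x q / x - 2 * (theta x q - delta_x theta x q) / x"
proof -
  have d: "((\<lambda>q. - theta x q / x) has_field_derivative - (delta_q theta x q / q) / x) (at q)"
    by (intro DERIV_cdivide DERIV_minus theta_E_deriv_q D)
  show ?thesis
    by (rule trans[OF iffD2[OF eq_diff_eq delta_q_shift[OF hol2_theta D theta_shift[OF D(1)] d]]], unfold theta_x_shift[OF D])
      (use D in \<open>simp_all add: field_simps\<close>)
qed

lemma E_q_shift: "delta_q E_fun (q^2 * x) q = q * E_fun x q + q * delta_q E_fun x q
    - (1 - q * x) * delta_q theta x q / x + q * theta x q
    - 2 * (q * delta_x E_fun x q + theta x q / x - (1 - q * x) * delta_x theta x q / x)"
proof -
  have d: "((\<lambda>q. q * E_fun x q - (1 - q * x) * theta x q / x) has_field_derivative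
      (q * (delta_q E_fun x q / q) + E_fun x q) - ((1 - q * x) * (delta_q theta x q / q) - x * theta x q) / x) (at q)"
    using D by (auto intro!: derivative_eq_intros theta_E_deriv_q simp: field_simps)
  show ?thesis
    by (rule trans[OF iffD2[OF eq_diff_eq delta_q_shift[OF hol2_E_fun D E_shift[OF D(1)] d]]], unfold E_x_shift[OF D])
      (use D in \<open>simp_all add: field_simps\<close>)
qed

text \<open>The multiplier is (-1 / x)^3 from the cube of theta times -q x from the heat operator
  applied to G. Expressed through values at x alone, the claim is a polynomial identity and holds
  also at zeros of theta.\<close>

lemma F_shift: "F_fun (q^2 * x) q = q / x^2 * F_fun x q"
  unfolding F_fun_def theta_shift[OF D] theta_x_shift[OF D] theta_xx_shift theta_q_shift
    E_shift[OF D] E_x_shift[OF D] E_xx_shift E_q_shift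
  using D by (simp add: field_simps) algebra

lemma theta_q_inverse: "delta_q theta (1 / x) q = - delta_q theta x q / x"
proof -
  have d: "((\<lambda>q. - theta x q / x) has_field_derivative - (delta_q theta x q / q) / x) (at q)"
    by (intro DERIV_cdivide DERIV_minus theta_E_deriv_q D)
  from delta_q_inverse[OF hol2_theta D(1,3) theta_inverse[OF D(1)] d]
  show ?thesis using D by simp
qed

lemma E_q_inverse: "delta_q E_fun (1 / x) q = delta_q E_fun x q / x"
proof -
  have d: "((\<lambda>q. E_fun x q / x) has_field_derivative (delta_q E_fun x q / q) / x) (at q)"
    by (intro DERIV_cdivide theta_E_deriv_q D)
  from delta_q_inverse[OF hol2_E_fun D(1,3) E_inverse[OF D(1)] d]
  show ?thesis using D by simp
qed

end

context
  fixes q :: complex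
  assumes D: "q \<noteq> 0" "norm q < 1"
begin

lemma theta_x_inverse:
  assumes "x \<noteq> 0"
  shows "delta_x theta (1 / x) q = (delta_x theta x q - theta x q) / x"
proof -
  have d: "((\<lambda>x. - theta x q / x) has_field_derivative
      (- (delta_x theta x q / x) * x - - theta x q * 1) / (x * x)) (at x)"
    by (intro DERIV_divide DERIV_minus DERIV_ident theta_E_deriv_x D assms)
  show ?thesis
    by (rule trans[OF delta_x_inverse[OF hol2_theta assms D(2) theta_inverse[OF _ D(2)] d]])
      (use assms in \<open>simp_all add: field_simps\<close>)
qed

lemma E_x_inverse:
  assumes "x \<noteq> 0"
  shows "delta_x E_fun (1 / x) q = (E_fun x q - delta_x E_fun x q) / x"
proof -
  have d: "((\<lambda>x. E_fun x q / x) has_field_derivative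
      (delta_x E_fun x q / x * x - E_fun x q * 1) / (x * x)) (at x)"
    by (intro DERIV_divide DERIV_ident theta_E_deriv_x D assms)
  show ?thesis
    by (rule trans[OF delta_x_inverse[OF hol2_E_fun assms D(2) E_inverse d]])
      (use assms in \<open>simp_all add: field_simps\<close>)
qed

lemma theta_xx_inverse:
  assumes "x \<noteq> 0"
  shows "delta_x (delta_x theta) (1 / x) q = - (delta_x (delta_x theta) x q - 2 * delta_x theta x q + theta x q) / x"
proof -
  have d: "((\<lambda>x. (delta_x theta x q - theta x q) / x) has_field_derivative
      ((delta_x (delta_x theta) x q / x - delta_x theta x q / x) * x - (delta_x theta x q - theta x q) * 1) / (x * x)) (at x)"
    by (intro DERIV_divide DERIV_diff DERIV_ident theta_E_deriv_x D assms)
  show ?thesis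
    by (rule trans[OF delta_x_inverse[OF hol2_delta_x[OF hol2_theta] assms D(2) theta_x_inverse d]])
      (use assms in \<open>simp_all add: field_simps\<close>)
qed

lemma E_xx_inverse:
  assumes "x \<noteq> 0"
  shows "delta_x (delta_x E_fun) (1 / x) q = (delta_x (delta_x E_fun) x q - 2 * delta_x E_fun x q + E_fun x q) / x"
proof -
  have d: "((\<lambda>x. (E_fun x q - delta_x E_fun x q) / x) has_field_derivative
      ((delta_x E_fun x q / x - delta_x (delta_x E_fun) x q / x) * x - (E_fun x q - delta_x E_fun x q) * 1) / (x * x)) (at x)"
    by (intro DERIV_divide DERIV_diff DERIV_ident theta_E_deriv_x D assms)
  show ?thesis
    by (rule trans[OF delta_x_inverse[OF hol2_delta_x[OF hol2_E_fun] assms D(2) E_x_inverse d]])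
      (use assms in \<open>simp_all add: field_simps\<close>)
qed

text \<open>G = E / theta is odd under inversion and the heat operator preserves this; theta^3
  contributes another sign and the factor x^(-3).\<close>

lemma F_inverse:
  assumes "x \<noteq> 0"
  shows "F_fun (1 / x) q = F_fun x q / x^3"
  unfolding F_fun_def theta_inverse[OF assms D(2)] theta_x_inverse[OF assms] theta_xx_inverse[OF assms]
    theta_q_inverse[OF assms D] E_inverse[OF assms] E_x_inverse[OF assms] E_xx_inverse[OF assms] E_q_inverse[OF assms D]
  using assms by (simp add: field_simps) algebra

end

subsection \<open>The differential equations\<close>

text \<open>Inversion fixes -1, and inversion followed by dilation fixes -q; at both points the
  relations give F = -F. Dilation by q^2 raises the exponent by 2, hence the two base cases, and
  inversion supplies the negative powers.\<close>

lemma F_zero: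
  assumes D: "q \<noteq> 0" "norm q < 1"
  shows "F_fun (- (q ^ k)) q = 0" "F_fun (- 1 / q ^ k) q = 0"
proof -
  show 1: "F_fun (- (q ^ k)) q = 0" for k
  proof (induction k rule: induct_nat_012)
    case 0
    then show ?case using F_inverse[OF D, of "-1"] by simp
  next
    case 1
    have "q^2 * (1 / - q) = - q" by (simp add: power2_eq_square)
    then have "F_fun (- q) q = q / (1 / - q)^2 * F_fun (1 / - q) q"
      using F_shift[of "1 / - q", OF _ D] D by simp
    also have "F_fun (1 / - q) q = F_fun (- q) q / (- q)^3"
      by (rule F_inverse[OF D]) (use D in auto)
    also have "q / (1 / - q)^2 * (F_fun (- q) q / (- q)^3) = - F_fun (- q) q"
      using D by (simp add: field_simps power2_eq_square power3_eq_cube)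
    finally show ?case by simp
  next
    case (ge2 k)
    then show ?case using F_shift[of "- (q ^ k)", OF _ D] D by (simp add: power2_eq_square mult.assoc)
  qed
  show "F_fun (- 1 / q ^ k) q = 0"
    using F_inverse[OF D, of "- (q ^ k)"] 1[of k] D by simp
qed

text \<open>Since theta vanishes at 1, only the last summand 2 E (delta_x theta)^2 of
  \<open>F_fun\<close> survives, so no derivative of the series is needed.\<close>

lemma F_fun_1:
  assumes q: "norm q < 1"
  shows "F_fun 1 q = 4 * qinf (q^2) (q^2) ^ 5 * (qinf (-q) q)^2"
proof -
  note p = norm_square_less_1[OF q]
  have t: "theta 1 q = 0" using p by (simp add: theta_def)
  have "delta_x theta 1 q = - ((qinf (q^2) (q^2))^2)"
    using J_fun_deriv_1[OF p] by (simp add: delta_x_def theta_def)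
  then show ?thesis
    by (simp add: F_fun_def t E_fun_def M_fun_1[OF q] power2_eq_square eval_nat_numeral)
qed

lemma J_fun_minus_1:
  assumes "norm q < 1"
  shows "J_fun (-1) q = 2 * (qinf (-q) q)^2"
  using assms by (simp add: J_fun_rec power2_eq_square)

lemma F_fun_eq_nonzero:
  assumes D: "q \<noteq> 0" "norm q < 1" and x: "x \<noteq> 0"
  shows "F_fun x q = 2 * qinf (q^2) (q^2) ^ 5 * (x * J_fun (-x) q)"
proof -
  define K where "K x = x * J_fun (-x) q" for x
  note p = norm_square_less_1[OF D(2)]
  have dK: "(K has_field_derivative (J_fun (-x) q - x * deriv (\<lambda>z. J_fun z q) (-x))) (at x)" if "x \<noteq> 0" for x
  proof -
    have "((\<lambda>x. J_fun (-x) q) has_field_derivative deriv (\<lambda>z. J_fun z q) (-x) * - 1) (at x)"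
      by (rule DERIV_chain2[OF J_fun_has_deriv[OF D(2)]]) (use that in \<open>auto intro!: derivative_eq_intros\<close>)
    then show ?thesis unfolding K_def by (auto intro!: derivative_eq_intros)
  qed
  have K1: "K 1 = 2 * (qinf (-q) q)^2" using J_fun_minus_1[OF D(2)] by (simp add: K_def)
  have Q: "qinf (-q) q \<noteq> 0" using qinf_Euler[OF D(2)] by auto
  obtain c where c: "\<And>x. x \<noteq> 0 \<Longrightarrow> F_fun x q = c * K x"
  proof (rule quasi_periodic_unique[where p = "q^2" and m = "\<lambda>x. q / x^2" and f = "\<lambda>x. F_fun x q" and g = K and ?x1.0 = 1])
    have "(\<lambda>x. F_fun x q) holomorphic_on {x. (x, q) \<in> DOM}"
      using hol2_F_fun unfolding hol2_def by blast
    then show "(\<lambda>x. F_fun x q) holomorphic_on - {0}"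
      by (rule holomorphic_on_subset) (use D in auto)
    show "K holomorphic_on - {0}"
      by (subst holomorphic_on_open) (use dK in auto)
    fix x :: complex assume x: "x \<noteq> 0"
    show "q / x^2 \<noteq> 0" using x D by simp
    show "F_fun (q^2 * x) q = q / x^2 * F_fun x q" by (rule F_shift[OF x D])
    have "J_fun (- (q^2 * x)) q = - J_fun (q * - x) q / (q * - x)"
      using J_fun_shift[OF D(2,1), of "q * - x"] x D by (simp add: power2_eq_square mult.assoc)
    also have "J_fun (q * - x) q = J_fun (- x) q / x"
      using J_fun_shift[OF D(2,1), of "- x"] x by simp
    finally show "K (q^2 * x) = q / x^2 * K x"
      using x D by (simp add: K_def field_simps power2_eq_square)
    assume Kx: "K x = 0"
    then have J: "J_fun (- x) q = 0" using x by (simp add: K_def)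
    have "- x \<noteq> 0" using x by simp
    then obtain k where k: "- x = q ^ k \<or> - x = 1 / q ^ k"
      using J_fun_eq_0_cases[OF D(2) _ J] by metis
    then have "x = - (q ^ k) \<or> x = - 1 / q ^ k" by (metis minus_divide_left minus_minus)
    then have "F_fun x q = 0" using F_zero[OF D] by auto
    \<comment> \<open>At a zero the derivative of \<open>K\<close> reduces to -x times the
      derivative of J at -x.\<close>
    moreover have "deriv K x \<noteq> 0"
      using DERIV_imp_deriv[OF dK[OF x]] J_fun_simple_zero[OF D(2,1) \<open>- x \<noteq> 0\<close> J] J x by simp
    ultimately show "F_fun x q = 0 \<and> deriv K x \<noteq> 0" ..
  qed (use D p K1 Q in auto)
  \<comment> \<open>Comparison at 1, where \<open>K\<close> is nonzero by Euler's identity; the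
    squares of (-q; q) cancel.\<close>
  have "c * K 1 = 4 * qinf (q^2) (q^2) ^ 5 * (qinf (-q) q)^2"
    using c[of 1] F_fun_1[OF D(2)] by simp
  then have "c = 2 * qinf (q^2) (q^2) ^ 5" using Q unfolding K1 by simp
  then show ?thesis using c[OF x] by (simp add: K_def)
qed

text \<open>Quasi-periodicity degenerates at q = 0; there the identity follows by continuity in q of
  both sides.\<close>

lemma F_fun_eq:
  assumes q: "norm q < 1" and x: "x \<noteq> 0"
  shows "F_fun x q = 2 * qinf (q^2) (q^2) ^ 5 * (x * J_fun (-x) q)"
proof (cases "q = 0")
  case True
  define g where "g = (\<lambda>x q. 2 * qinf (q^2) (q^2) ^ 5 * (x * J_fun (-x) q))"
  have "hol2 (\<lambda>x q. J_fun (-x) q) DOM"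
    by (rule hol2_compose[OF hol2_J_fun hol2_minus[OF hol2_fst] hol2_snd]) (auto simp: open_DOM)
  then have "hol2 g DOM" unfolding g_def
    by (intro hol2_mult hol2_power hol2_const hol2_qinf_compose hol2_snd hol2_fst open_DOM)
       (auto simp: norm_power power_less_one_iff)
  then have "isCont (g x) 0"
    using hol2_D(2)[of g DOM x 0] x by (intro DERIV_isCont) auto
  then have 1: "g x \<midarrow>0\<rightarrow> g x 0" by (simp add: isCont_def)
  have "isCont (F_fun x) 0"
    using hol2_D(2)[OF hol2_F_fun, of x 0] x by (intro DERIV_isCont) auto
  then have 2: "F_fun x \<midarrow>0\<rightarrow> F_fun x 0" by (simp add: isCont_def)
  have 3: "\<forall>\<^sub>F r in at 0. F_fun x r = g x r"
    unfolding eventually_at g_def using F_fun_eq_nonzero[OF _ _ x] by (intro exI[of _ 1]) auto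
  have "F_fun x 0 = g x 0" by (rule LIM_unique[OF Lim_transform_eventually[OF 2 3] 1])
  then show ?thesis by (simp add: True g_def)
qed (use F_fun_eq_nonzero assms in auto)

section \<open>From the numerator back to the series\<close>

lemma theta_neq_0:
  assumes q: "norm q < 1" and x: "x \<noteq> 0" "x \<noteq> 1"
    and k: "\<And>k::nat. k \<ge> 1 \<Longrightarrow> x * (q^2) ^ k \<noteq> 1 \<and> (q^2) ^ k \<noteq> x"
  shows "theta x q \<noteq> 0"
proof -
  note p = norm_square_less_1[OF q]
  have "x * (q^2) ^ t \<noteq> 1" for t using k[of t] x by (cases t) auto
  moreover have "q^2 / x * (q^2) ^ t \<noteq> 1" for t using k[of "Suc t"] x by (auto simp: field_simps)
  ultimately show ?thesis
    unfolding theta_def J_fun_eq[OF p] mult_eq_0_iff qinf_eq_0_iff[OF p] by blast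
qed

text \<open>A derivative sees only a neighbourhood, so equality on an open set suffices; the series
  agrees with M / theta only away from the zeros of theta.\<close>

lemma delta_cong:
  assumes "open U" "(x, q) \<in> U" "\<And>y r. (y, r) \<in> U \<Longrightarrow> f y r = g y r"
  shows "delta_x f x q = delta_x g x q" "delta_q f x q = delta_q g x q"
proof -
  have "\<forall>\<^sub>F y in nhds x. f y q = g y q"
    using eventually_nhds_in_open[OF open_slices(1)[OF assms(1)], of x q] assms(2)
    by (auto elim: eventually_mono simp: assms(3))
  then show "delta_x f x q = delta_x g x q" by (simp add: delta_x_def deriv_cong_ev)
  have "\<forall>\<^sub>F r in nhds q. f x r = g x r"
    using eventually_nhds_in_open[OF open_slices(2)[OF assms(1)], of q x] assms(2)
    by (auto elim: eventually_mono simp: assms(3))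
  then show "delta_q f x q = delta_q g x q" by (simp add: delta_q_def deriv_cong_ev)
qed

lemma delta_mult:
  assumes "hol2 f S" "hol2 g S" "(x, q) \<in> S"
  shows "delta_x (\<lambda>x q. f x q * g x q) x q = delta_x f x q * g x q + f x q * delta_x g x q"
    "delta_q (\<lambda>x q. f x q * g x q) x q = delta_q f x q * g x q + f x q * delta_q g x q"
  using DERIV_imp_deriv[OF DERIV_mult[OF hol2_D(1)[OF assms(1,3)] hol2_D(1)[OF assms(2,3)]]]
    DERIV_imp_deriv[OF DERIV_mult[OF hol2_D(2)[OF assms(1,3)] hol2_D(2)[OF assms(2,3)]]]
  by (simp_all add: delta_x_def delta_q_def algebra_simps)

lemma delta_add:
  assumes "hol2 f S" "hol2 g S" "(x, q) \<in> S"
  shows "delta_x (\<lambda>x q. f x q + g x q) x q = delta_x f x q + delta_x g x q"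
    "delta_q (\<lambda>x q. f x q + g x q) x q = delta_q f x q + delta_q g x q"
  using DERIV_imp_deriv[OF DERIV_add[OF hol2_D(1)[OF assms(1,3)] hol2_D(1)[OF assms(2,3)]]]
    DERIV_imp_deriv[OF DERIV_add[OF hol2_D(2)[OF assms(1,3)] hol2_D(2)[OF assms(2,3)]]]
  by (simp_all add: delta_x_def delta_q_def algebra_simps)

lemma delta_linear:
  "delta_x (\<lambda>x q. a + b * x) x q = b * x" "delta_q (\<lambda>x q. a + b * x) x q = 0"
  using DERIV_imp_deriv[of "\<lambda>x. a + b * x" b x]
  by (auto simp: delta_x_def delta_q_def intro!: derivative_eq_intros)

text \<open>The general linear factor serves twice: 1 + x for the first equation and 1 - x for the
  passage from \<open>N_star\<close> to \<open>N_fun\<close>.\<close>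

lemma delta_linear_mult:
  assumes f: "hol2 f S" and S: "(x, q) \<in> S"
  shows "delta_x (\<lambda>x q. (a + b * x) * f x q) x q = b * x * f x q + (a + b * x) * delta_x f x q"
    and "delta_q (\<lambda>x q. (a + b * x) * f x q) x q = (a + b * x) * delta_q f x q"
    and "delta_x (delta_x (\<lambda>x q. (a + b * x) * f x q)) x q =
      b * x * f x q + 2 * b * x * delta_x f x q + (a + b * x) * delta_x (delta_x f) x q"
proof -
  have oS: "open S" using f by (simp add: hol2_def)
  have l: "hol2 (\<lambda>x q. a + b * x) S" "hol2 (\<lambda>x q. 0 + b * x) S" for a
    by (intro hol2_add hol2_mult hol2_const hol2_fst oS)+
  have 1: "delta_x (\<lambda>x q. (a + b * x) * f x q) x q = (0 + b * x) * f x q + (a + b * x) * delta_x f x q"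
    if "(x, q) \<in> S" for x q
    using delta_mult(1)[OF l(1) f that] by (simp add: delta_linear)
  show "delta_x (\<lambda>x q. (a + b * x) * f x q) x q = b * x * f x q + (a + b * x) * delta_x f x q"
    using 1[OF S] by simp
  show "delta_q (\<lambda>x q. (a + b * x) * f x q) x q = (a + b * x) * delta_q f x q"
    using delta_mult(2)[OF l(1) f S] by (simp add: delta_linear)
  note f' = hol2_delta_x[OF f]
  have "delta_x (delta_x (\<lambda>x q. (a + b * x) * f x q)) x q =
      delta_x (\<lambda>x q. (0 + b * x) * f x q + (a + b * x) * delta_x f x q) x q"
    by (rule delta_cong(1)[OF oS S 1])
  also have "\<dots> = delta_x (\<lambda>x q. (0 + b * x) * f x q) x q + delta_x (\<lambda>x q. (a + b * x) * delta_x f x q) x q"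
    by (rule delta_add(1)[OF hol2_mult[OF l(2) f] hol2_mult[OF l(1) f'] S])
  finally show "delta_x (delta_x (\<lambda>x q. (a + b * x) * f x q)) x q =
      b * x * f x q + 2 * b * x * delta_x f x q + (a + b * x) * delta_x (delta_x f) x q"
    using delta_mult(1)[OF l(2) f S] delta_mult(1)[OF l(1) f' S]
      delta_linear[of 0 b] delta_linear[of a b] by (simp add: algebra_simps)
qed

text \<open>The source of the expression \<open>F_fun\<close>: with \<open>R\<close> =
  \<open>E\<close> / \<open>t\<close>, the product rule for \<open>E\<close> = \<open>R\<close> *
  \<open>t\<close> replaces the quotient rule and avoids all denominators.\<close>

lemma heat_equation_quotient:
  assumes R: "hol2 R S" and t: "hol2 t S" and S: "(x, q) \<in> S"
  defines "E \<equiv> \<lambda>x q. R x q * t x q"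
  shows "t x q ^ 3 * (delta_q R x q + delta_x (delta_x R) x q) =
     t x q ^ 2 * delta_q E x q - t x q * E x q * delta_q t x q
     + t x q ^ 2 * delta_x (delta_x E) x q - 2 * t x q * delta_x E x q * delta_x t x q
     - t x q * E x q * delta_x (delta_x t) x q + 2 * E x q * delta_x t x q ^ 2"
proof -
  have oS: "open S" using R by (simp add: hol2_def)
  note R' = hol2_delta_x[OF R] and t' = hol2_delta_x[OF t]
  have "delta_x (delta_x E) x q = delta_x (\<lambda>x q. delta_x R x q * t x q + R x q * delta_x t x q) x q"
    unfolding E_def by (rule delta_cong(1)[OF oS S]) (rule delta_mult(1)[OF R t])
  also have "\<dots> = delta_x (\<lambda>x q. delta_x R x q * t x q) x q + delta_x (\<lambda>x q. R x q * delta_x t x q) x q"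
    by (rule delta_add(1)[OF hol2_mult[OF R' t] hol2_mult[OF R t'] S])
  also have "\<dots> = delta_x (delta_x R) x q * t x q + delta_x R x q * delta_x t x q +
      (delta_x R x q * delta_x t x q + R x q * delta_x (delta_x t) x q)"
    by (simp only: delta_mult(1)[OF R' t S] delta_mult(1)[OF R t' S])
  finally have xx: "delta_x (delta_x E) x q = \<dots>" .
  have x: "delta_x E x q = delta_x R x q * t x q + R x q * delta_x t x q"
    and q: "delta_q E x q = delta_q R x q * t x q + R x q * delta_q t x q"
    unfolding E_def by (rule delta_mult[OF R t S])+
  show ?thesis unfolding xx x q unfolding E_def by algebra
qed

definition regular_domain :: "(complex \<times> complex) set" where
  "regular_domain = {(x, q) \<in> DOM. theta x q \<noteq> 0}"

lemma open_regular_domain: "open regular_domain"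
proof -
  have "regular_domain = DOM \<inter> (\<lambda>(x, q). theta x q) -` (- {0})"
    by (auto simp: regular_domain_def)
  then show ?thesis
    using continuous_open_preimage[of DOM "\<lambda>(x, q). theta x q" "- {0}"] hol2_theta open_DOM
    by (auto simp: hol2_def)
qed

lemma N_star_regular: "(x, q) \<in> regular_domain \<Longrightarrow> N_star x q = M_fun x q / theta x q"
  by (auto simp: regular_domain_def theta_def N_star_eq)

lemma hol2_N_star: "hol2 N_star regular_domain"
proof (rule hol2_cong)
  show "hol2 (\<lambda>x q. M_fun x q / theta x q) regular_domain"
    by (rule hol2_divide[OF hol2_subset[OF hol2_M_fun open_regular_domain]
          hol2_subset[OF hol2_theta open_regular_domain]])
       (auto simp: regular_domain_def)
qed (simp add: N_star_regular)

lemma C_star_eq: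
  assumes "norm q < 1"
  shows "C_star x (q^2) = qinf (q^2) (q^2) / theta x q"
  using norm_square_less_1[OF assms]
  by (simp add: C_star_def C_fun_def theta_def J_fun_rec qpoch_inf_pair)

lemma N_star_equation:
  assumes U: "(x, q) \<in> regular_domain"
  shows "2 * x * (qinf (q^2) (q^2))^2 * (C_star x (q^2))^3 * J_fun (-x) q
    = (1 + x) * delta_q N_star x q + x * N_star x q
      + 2 * x * delta_x N_star x q + (1 + x) * delta_x (delta_x N_star) x q"
proof -
  define G where "G = (\<lambda>x q. (1 + 1 * x) * N_star x q)"
  have D: "x \<noteq> 0" "norm q < 1" and t: "theta x q \<noteq> 0" using U by (auto simp: regular_domain_def)
  have G: "hol2 G regular_domain" unfolding G_def
    by (intro hol2_mult hol2_add hol2_const hol2_fst open_regular_domain hol2_N_star)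
  have th: "hol2 theta regular_domain"
    by (rule hol2_subset[OF hol2_theta open_regular_domain]) (auto simp: regular_domain_def)
  have GE: "G y r * theta y r = E_fun y r" if "(y, r) \<in> regular_domain" for y r
    using that N_star_regular[OF that] by (simp add: G_def E_fun_def regular_domain_def)
  have 1: "delta_x (\<lambda>x q. G x q * theta x q) y r = delta_x E_fun y r"
    "delta_q (\<lambda>x q. G x q * theta x q) y r = delta_q E_fun y r" if "(y, r) \<in> regular_domain" for y r
    by (rule delta_cong[OF open_regular_domain that GE]; assumption)+
  have 2: "delta_x (delta_x (\<lambda>x q. G x q * theta x q)) x q = delta_x (delta_x E_fun) x q"
    by (rule delta_cong(1)[OF open_regular_domain U 1(1)])
  have "theta x q ^ 3 * (delta_q G x q + delta_x (delta_x G) x q) = F_fun x q"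
    unfolding heat_equation_quotient[OF G th U] F_fun_def 1[OF U] 2 GE[OF U] ..
  then have "delta_q G x q + delta_x (delta_x G) x q = F_fun x q / theta x q ^ 3"
    using t by (simp add: field_simps)
  \<comment> \<open>The fifth power of (q^2; q^2) splits as 2 + 3: three factors join theta^(-3) to
    form the cube of \<open>C_star\<close>.\<close>
  also have "\<dots> = 2 * x * (qinf (q^2) (q^2))^2 * (C_star x (q^2))^3 * J_fun (-x) q"
    unfolding F_fun_eq[OF D(2,1)] C_star_eq[OF D(2)] by (simp add: power_divide eval_nat_numeral mult_ac)
  finally show ?thesis
    unfolding G_def delta_linear_mult[OF hol2_N_star U] by (simp add: algebra_simps)
qed

theorem theorem5p2:
  fixes x q :: complex
  assumes "norm q < 1"
    and "x \<noteq> 0"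
    and "\<And>k::nat. k \<ge> 1 \<Longrightarrow> x * (q^2) ^ k \<noteq> 1 \<and> (q^2) ^ k \<noteq> x"
  shows "(x \<noteq> 1 \<longrightarrow>
      2 * x * (qpoch_inf [q^2] (q^2))^2 * (C_star x (q^2))^3 * J_fun (-x) q
        = (1 + x) * delta_q N_star x q + x * N_star x q
          + 2 * x * delta_x N_star x q + (1 + x) * delta_x (delta_x N_star) x q) \<and>
      2 * x * (qpoch_inf [q^2] (q^2))^2 * (C_fun x (q^2))^3 * J_fun (-x) q
        = (1 + x) * (1 - x)^2 * delta_q N_fun x q + 2 * x * (1 + x) * N_fun x q
          + 4 * x * (1 - x) * delta_x N_fun x q
          + (1 + x) * (1 - x)^2 * delta_x (delta_x N_fun) x q"
proof (cases "x = 1")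
  case True
  \<comment> \<open>At x = 1 all derivative terms carry a factor 1 - x, so the second equation
    reduces to an evaluation of 4 \<open>N_fun 1 q\<close>, known from the q-Gauss sum.\<close>
  let ?P = "qinf (q^2) (q^2)"
  have P: "?P \<noteq> 0" by (rule qinf_self_neq_0[OF norm_square_less_1[OF assms(1)]])
  have N1: "N_fun 1 q = (qinf (-q) q)^2 / ?P"
    using N_fun_eq[OF assms(1), of 1] P by (simp add: M_fun_1[OF assms(1)])
  have C1: "C_fun 1 (q^2) = 1 / ?P"
    using P by (simp add: C_fun_def qpoch_inf_pair norm_square_less_1[OF assms(1)])
  show ?thesis
    unfolding True N1 C1 J_fun_minus_1[OF assms(1)] using P by (simp add: field_simps eval_nat_numeral)
next
  case False
  then have U: "(x, q) \<in> regular_domain"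
    using theta_neq_0[OF assms(1,2) _ assms(3)] assms(1,2) by (simp add: regular_domain_def)
  \<comment> \<open>Valid on the regular domain because theta vanishes at 1, which keeps the
    denominator 1 - y away from 0.\<close>
  have N: "N_fun y r = (1 + (-1) * y) * N_star y r" if "(y, r) \<in> regular_domain" for y r
    using that by (auto simp: N_star_def regular_domain_def theta_def norm_square_less_1)
  have 1: "delta_x N_fun y r = delta_x (\<lambda>x q. (1 + (-1) * x) * N_star x q) y r"
    "delta_q N_fun y r = delta_q (\<lambda>x q. (1 + (-1) * x) * N_star x q) y r" if "(y, r) \<in> regular_domain" for y r
    by (rule delta_cong[OF open_regular_domain that N]; assumption)+
  have 2: "delta_x (delta_x N_fun) x q = delta_x (delta_x (\<lambda>x q. (1 + (-1) * x) * N_star x q)) x q"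
    by (rule delta_cong(1)[OF open_regular_domain U 1(1)])
  have C: "C_fun x (q^2) = (1 - x) * C_star x (q^2)" using False by (simp add: C_star_def)
  note star = N_star_equation[OF U]
  \<comment> \<open>The second equation is (1 - x)^3 times the first, with the derivatives of
    \<open>N_fun\<close> expanded through \<open>N_star\<close>.\<close>
  have "2 * x * (qinf (q^2) (q^2))^2 * (C_fun x (q^2))^3 * J_fun (-x) q
      = (1 - x)^3 * (2 * x * (qinf (q^2) (q^2))^2 * (C_star x (q^2))^3 * J_fun (-x) q)"
    unfolding C by (simp add: power_mult_distrib)
  also have "\<dots> = (1 + x) * (1 - x)^2 * delta_q N_fun x q + 2 * x * (1 + x) * N_fun x q
      + 4 * x * (1 - x) * delta_x N_fun x q + (1 + x) * (1 - x)^2 * delta_x (delta_x N_fun) x q"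
    unfolding star 2 unfolding 1[OF U] N[OF U] delta_linear_mult[OF hol2_N_star U] by algebra
  finally show ?thesis using star by blast
qed

end
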